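(* Consider a general network of beams as described in the context and $T>0$. The transformation $\mathcal T_{\mathrm{net}}:\overline E_1\to\overline E_2$ defined in the context is bijective if $(\mathbf p_i^0,\mathbf R_i^0)\in C^2([0,\ell_i];\mathbb R^3\times\mathrm{SO}(3))$ for $i\in\mathcal I$, $(f_n^{\mathbf p},f_n^{\mathbf R})\in C^2([0,T];\mathbb R^3\times\mathrm{SO}(3))$ for $n\in\mathcal N_S^D$, and $$(f_n^{\mathbf p},f_n^{\mathbf R})(0)=(\mathbf p_{i^n}^0,\mathbf R_{i^n}^0)(\mathbf x_{i^n}^n),\qquad n\in\mathcal N_S^D.$$
   Context: For $u,\zeta\in\mathbb R^3$, $\widehat u\,\zeta=u\times\zeta$ and $\mathrm{vec}(\widehat u)=u$. $e_1=(1,0,0)^\intercal$. Network. $N$ beams indexed by $\mathcal I=\{1,\dots,N\}$ are the edges of an oriented graph; edge $i$ is identified with $[0,\ell_i]$, $\ell_i>0$, its endpoints $x=0$ and $x=\ell_i$ corresponding to two (distinct) nodes. $\mathcal N_S$ is the set of simple nodes (exactly one incident edge), partitioned as $\mathcal N_S=\mathcal N_S^D\cup\mathcal N_S^N$. For $n\in\mathcal N_S$, $i^n$ is the index of the unique incident edge and $\mathbf x_{i^n}^n\in\{0,\ell_{i^n}\}$ is the end of $[0,\ell_{i^n}]$ corresponding to $n$. Beam data: $\mathbf C_i\in C^1([0,\ell_i];\mathbb R^{6\times6})$ with symmetric positive definite values, $R_i\in C^2([0,\ell_i];\mathrm{SO}(3))$, $\Upsilon_{c,i}=\mathrm{vec}(R_i^\intercal\frac{\mathrm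 d}{\mathrm dx}R_i)$. Transformation: $\mathcal T_{\mathrm{net}}((\mathbf p_i,\mathbf R_i)_{i\in\mathcal I})=(\mathcal T_i(\mathbf p_i,\mathbf R_i))_{i\in\mathcal I}$, with $\mathcal T_i(\mathbf p_i,\mathbf R_i)=\begin{bmatrix}v_i\\ z_i\end{bmatrix}$, $$v_i=\begin{bmatrix}\mathbf R_i^\intercal\partial_t\mathbf p_i\\ \mathrm{vec}(\mathbf R_i^\intercal\partial_t\mathbf R_i)\end{bmatrix},\quad z_i=\mathbf C_i^{-1}\begin{bmatrix}\mathbf R_i^\intercal\partial_x\mathbf p_i-e_1\\ \mathrm{vec}(\mathbf R_i^\intercal\partial_x\mathbf R_i)-\Upsilon_{c,i}\end{bmatrix}.$$ $\overline E_1$ is the set of $(\mathbf p_i,\mathbf R_i)_{i\in\mathcal I}\in\prod_{i=1}^NC^2([0,\ell_i]\times[0,T];\mathbb R^3\times\mathrm{SO}(3))$ such that $(\mathbf p_{i^n},\mathbf R_{i^n})(\mathbf x_{i^n}^n,t)=(f_n^{\mathbf p},f_n^{\mathbf R})(t)$ for $t\in(0,T)$, $n\in\mathcal N_S^D$, and $(\mathbf p_i,\mathbf R_i)(x,0)=(\mathbf p_i^0,\mathbf R_i^0)(x)$ for $x\in(0,\ell_i)$, $i\in\mathcal I$. $\overline E_2$ is the set of $(y_i=(v_i^\intercal,z_i^\intercal)^\intercal)_{i\in\mathcal I}\in\prod_{i=1}^NC^1([0,\ell_i]\times[0,T];\mathbb R^{12})$ such that, with $s_i:=\mathbf C_iz_i$,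 $v_i=(v_{i,1}^\intercal,v_{i,2}^\intercal)^\intercal$, $s_i=(s_{i,1}^\intercal,s_{i,2}^\intercal)^\intercal$ (components in $\mathbb R^3$): $$\partial_t\begin{bmatrix}s_{i,1}\\ s_{i,2}\end{bmatrix}-\partial_x\begin{bmatrix}v_{i,1}\\ v_{i,2}\end{bmatrix}-\begin{bmatrix}\widehat\Upsilon_{c,i}&\widehat e_1\\ 0&\widehat\Upsilon_{c,i}\end{bmatrix}\begin{bmatrix}v_{i,1}\\ v_{i,2}\end{bmatrix}=-\begin{bmatrix}\widehat v_{i,2}&\widehat v_{i,1}\\ 0&\widehat v_{i,2}\end{bmatrix}\begin{bmatrix}s_{i,1}\\ s_{i,2}\end{bmatrix}\ \text{in }(0,\ell_i)\times(0,T),\ i\in\mathcal I;$$ $$\tfrac{\mathrm d}{\mathrm dx}\mathbf p_i^0=\mathbf R_i^0(s_{i,1}(\cdot,0)+e_1),\quad\tfrac{\mathrm d}{\mathrm dx}\mathbf R_i^0=\mathbf R_i^0(\widehat s_{i,2}(\cdot,0)+\widehat\Upsilon_{c,i})\ \text{in }(0,\ell_i),\ i\in\mathcal I;$$ $$\tfrac{\mathrm d}{\mathrm dt}f_n^{\mathbf p}=f_n^{\mathbf R}\,v_{i^n,1}(\mathbf x_{i^n}^n,\cdot),\quad\tfrac{\mathrm d}{\mathrm dt}f_n^{\mathbf R}=f_n^{\mathbf R}\,\widehat v_{i^n,2}(\mathbf x_{i^n}^n,\cdot)\ \text{in }(0,T),\ n\in\mathcal N_S^D.$$ *)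

theory Defs
  imports "HOL-Analysis.Analysis" "Graph_Theory.Digraph"
begin

section \<open>Vectors and matrices in block form\<close>

text \<open>
  \<open>\<real>\<^sup>6\<close> and \<open>\<real>\<^sup>1\<^sup>2\<close> are indexed by sum types of cardinality 6 and 12, so that a column
  of two blocks and a two by two block matrix can be written down directly.
\<close>

type_synonym R3 = "real ^ 3"
type_synonym R33 = "real ^ 3 ^ 3"
type_synonym R6 = "real ^ (3 + 3)"
type_synonym R66 = "real ^ (3 + 3) ^ (3 + 3)"
type_synonym R12 = "real ^ ((3 + 3) + (3 + 3))"

definition stack :: "'a ^ 'm \<Rightarrow> 'a ^ 'n \<Rightarrow> 'a ^ ('m + 'n)" where
  "stack a b = (\<chi> i. case i of Inl j \<Rightarrow> a $ j | Inr j \<Rightarrow> b $ j)"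

definition upper :: "'a ^ ('m::finite + 'n::finite) \<Rightarrow> 'a ^ 'm" where
  "upper y = (\<chi> j. y $ Inl j)"

definition lower :: "'a ^ ('m::finite + 'n::finite) \<Rightarrow> 'a ^ 'n" where
  "lower y = (\<chi> j. y $ Inr j)"

definition block_matrix ::
  "'a ^ 'm ^ 'm \<Rightarrow> 'a ^ 'n ^ 'm \<Rightarrow> 'a ^ 'm ^ 'n \<Rightarrow> 'a ^ 'n ^ 'n \<Rightarrow> 'a ^ ('m + 'n) ^ ('m + 'n)" where
  "block_matrix A B C D =
     (\<chi> i. case i of Inl k \<Rightarrow> stack (A $ k) (B $ k) | Inr k \<Rightarrow> stack (C $ k) (D $ k))"

definition spd_matrix :: "real ^ 'n ^ 'n \<Rightarrow> bool" where
  "spd_matrix A \<longleftrightarrow> transpose A = A \<and> (\<forall>\<xi>. \<xi> \<noteq> 0 \<longrightarrow> \<xi> \<bullet> (A *v \<xi>) > 0)"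

definition hat :: "R3 \<Rightarrow> R33" where
  "hat u = matrix (\<lambda>\<zeta>. cross3 u \<zeta>)"

text \<open>Meaningful for skew-symmetric arguments only.\<close>
definition axial :: "R33 \<Rightarrow> R3" where
  "axial A = (THE u. hat u = A)"

abbreviation SO3 :: "R33 set" where
  "SO3 \<equiv> {Q. rotation_matrix Q}"

abbreviation e1 :: R3 where
  "e1 \<equiv> axis 1 1"

lemma hat_mult: "hat u *v \<zeta> = cross3 u \<zeta>"
  by (simp add: hat_def matrix_def matrix_vector_mult_def cross3_def vec_eq_iff forall_3 sum_3
      axis_def)

lemma axial_hat: "axial (hat u) = u"
  unfolding axial_def
proof (rule the_equality)
  fix w assume "hat w = hat u"
  then have eq: "cross3 w \<zeta> = cross3 u \<zeta>" for \<zeta>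
    by (metis hat_mult)
  show "w = u"
    using eq[of "axis 1 1"] eq[of "axis 2 1"]
    by (simp add: cross3_def vec_eq_iff forall_3 axis_def)
qed simp

section \<open>Spaces of continuously differentiable maps\<close>

text \<open>
  Only closed intervals and rectangles with nonempty interior occur as \<open>S\<close>. On such sets the
  derivative within \<open>S\<close> is unique, and it is one-sided at the boundary. Since the dimension is
  finite, continuity of all directional derivatives is continuity of the derivative.
\<close>

primrec C_diff_on ::
  "nat \<Rightarrow> 'a::real_normed_vector set \<Rightarrow> ('a \<Rightarrow> 'b::real_normed_vector) \<Rightarrow> bool" where
  "C_diff_on 0 S f \<longleftrightarrow> continuous_on S f"
| "C_diff_on (Suc k) S f \<longleftrightarrow>
     (\<exists>f'. (\<forall>x\<in>S. (f has_derivative f' x) (at x within S)) \<and>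
           (\<forall>h. C_diff_on k S (\<lambda>x. f' x h)))"

text \<open>
  Members are \<open>undefined\<close> outside \<open>S\<close>, so that they are equal iff they agree on \<open>S\<close>.
\<close>
definition C_space ::
  "nat \<Rightarrow> 'a::real_normed_vector set \<Rightarrow> 'b::real_normed_vector set \<Rightarrow> ('a \<Rightarrow> 'b) set" where
  "C_space k S U = {f \<in> S \<rightarrow>\<^sub>E U. C_diff_on k S f}"

text \<open>Partial derivatives of a function of \<open>(x, t)\<close> on \<open>[0, L] \<times> [0, T]\<close>.\<close>

definition dx :: "real \<Rightarrow> (real \<times> real \<Rightarrow> 'b::real_normed_vector) \<Rightarrow> real \<times> real \<Rightarrow> 'b" where
  "dx L f = (\<lambda>(x, t). vector_derivative (\<lambda>\<xi>. f (\<xi>, t)) (at x within {0..L}))"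

definition dt :: "real \<Rightarrow> (real \<times> real \<Rightarrow> 'b::real_normed_vector) \<Rightarrow> real \<times> real \<Rightarrow> 'b" where
  "dt T f = (\<lambda>(x, t). vector_derivative (\<lambda>\<tau>. f (x, \<tau>)) (at t within {0..T}))"

section \<open>The network\<close>

definition incident_arcs :: "('n, 'e) pre_digraph \<Rightarrow> 'n \<Rightarrow> 'e set" where
  "incident_arcs G n = in_arcs G n \<union> out_arcs G n"

definition simple_nodes :: "('n, 'e) pre_digraph \<Rightarrow> 'n set" where
  "simple_nodes G = {n \<in> verts G. card (incident_arcs G n) = 1}"

definition the_arc :: "('n, 'e) pre_digraph \<Rightarrow> 'n \<Rightarrow> 'e" where
  "the_arc G n = (THE i. i \<in> incident_arcs G n)"

text \<open>The tail of an edge is its endpoint \<open>x = 0\<close>, the head its endpoint \<open>x = len i\<close>.\<close>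
definition the_end :: "('n, 'e) pre_digraph \<Rightarrow> ('e \<Rightarrow> real) \<Rightarrow> 'n \<Rightarrow> real" where
  "the_end G len n = (if tail G (the_arc G n) = n then 0 else len (the_arc G n))"

locale beam_network = fin_digraph G + loopfree_digraph G
  for G :: "('n, nat) pre_digraph" +
  fixes N :: nat
    and nodes_D nodes_N :: "'n set"
    and len :: "nat \<Rightarrow> real"
    and C :: "nat \<Rightarrow> real \<Rightarrow> R66"
    and Rc :: "nat \<Rightarrow> real \<Rightarrow> R33"
  assumes arcs_eq: "arcs G = {1..N}"
    and simple_nodes_eq: "simple_nodes G = nodes_D \<union> nodes_N"
    and nodes_disjoint: "nodes_D \<inter> nodes_N = {}"
    and len_pos: "i \<in> {1..N} \<Longrightarrow> len i > 0"
    and C_C1: "i \<in> {1..N} \<Longrightarrow> C_diff_on 1 {0..len i} (C i)"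
    and C_spd: "i \<in> {1..N} \<Longrightarrow> x \<in> {0..len i} \<Longrightarrow> spd_matrix (C i x)"
    and Rc_C2: "i \<in> {1..N} \<Longrightarrow> C_diff_on 2 {0..len i} (Rc i)"
    and Rc_SO3: "i \<in> {1..N} \<Longrightarrow> x \<in> {0..len i} \<Longrightarrow> Rc i x \<in> SO3"

definition curv :: "real \<Rightarrow> (real \<Rightarrow> R33) \<Rightarrow> real \<Rightarrow> R3" where
  "curv L R x = axial (transpose (R x) ** vector_derivative R (at x within {0..L}))"

section \<open>The transformation\<close>

definition velocity :: "real \<Rightarrow> (real \<times> real \<Rightarrow> R3 \<times> R33) \<Rightarrow> real \<times> real \<Rightarrow> R6" where
  "velocity T q w =
     (let p = fst \<circ> q; R = snd \<circ> q in
      stack (transpose (R w) *v dt T p w) (axial (transpose (R w) ** dt T R w)))"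

definition stress ::
  "real \<Rightarrow> (real \<Rightarrow> R66) \<Rightarrow> (real \<Rightarrow> R33) \<Rightarrow> (real \<times> real \<Rightarrow> R3 \<times> R33) \<Rightarrow> real \<times> real \<Rightarrow> R6" where
  "stress L C Rc q w =
     (let p = fst \<circ> q; R = snd \<circ> q in
      matrix_inv (C (fst w)) *v
        stack (transpose (R w) *v dx L p w - e1)
              (axial (transpose (R w) ** dx L R w) - curv L Rc (fst w)))"

definition T_beam ::
  "real \<Rightarrow> real \<Rightarrow> (real \<Rightarrow> R66) \<Rightarrow> (real \<Rightarrow> R33) \<Rightarrow>
   (real \<times> real \<Rightarrow> R3 \<times> R33) \<Rightarrow> real \<times> real \<Rightarrow> R12" where
  "T_beam T L C Rc q =
     (\<lambda>w \<in> {0..L} \<times> {0..T}. stack (velocity T q w) (stress L C Rc q w))"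

definition T_net ::
  "nat \<Rightarrow> real \<Rightarrow> (nat \<Rightarrow> real) \<Rightarrow> (nat \<Rightarrow> real \<Rightarrow> R66) \<Rightarrow> (nat \<Rightarrow> real \<Rightarrow> R33) \<Rightarrow>
   (nat \<Rightarrow> real \<times> real \<Rightarrow> R3 \<times> R33) \<Rightarrow> nat \<Rightarrow> real \<times> real \<Rightarrow> R12" where
  "T_net N T len C Rc q = (\<lambda>i \<in> {1..N}. T_beam T (len i) (C i) (Rc i) (q i))"

section \<open>The spaces\<close>

definition E1 ::
  "('n, nat) pre_digraph \<Rightarrow> nat \<Rightarrow> 'n set \<Rightarrow> real \<Rightarrow> (nat \<Rightarrow> real) \<Rightarrow>
   (nat \<Rightarrow> real \<Rightarrow> R3) \<Rightarrow> (nat \<Rightarrow> real \<Rightarrow> R33) \<Rightarrow> ('n \<Rightarrow> real \<Rightarrow> R3) \<Rightarrow> ('n \<Rightarrow> real \<Rightarrow> R33) \<Rightarrow>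
   (nat \<Rightarrow> real \<times> real \<Rightarrow> R3 \<times> R33) set" where
  "E1 G N nodes_D T len p0 R0 fp fR =
     {q \<in> (\<Pi>\<^sub>E i\<in>{1..N}. C_space 2 ({0..len i} \<times> {0..T}) (UNIV \<times> SO3)).
        (\<forall>n\<in>nodes_D. \<forall>t\<in>{0<..<T}. q (the_arc G n) (the_end G len n, t) = (fp n t, fR n t)) \<and>
        (\<forall>i\<in>{1..N}. \<forall>x\<in>{0<..<len i}. q i (x, 0) = (p0 i x, R0 i x))}"

text \<open>For \<open>y\<close> with blocks \<open>v\<close> and \<open>z\<close>, this is \<open>s = C z\<close>.\<close>
definition strain :: "(real \<Rightarrow> R66) \<Rightarrow> (real \<times> real \<Rightarrow> R12) \<Rightarrow> real \<times> real \<Rightarrow> R6" where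
  "strain C y w = C (fst w) *v lower (y w)"

definition compat_eq ::
  "real \<Rightarrow> real \<Rightarrow> (real \<Rightarrow> R66) \<Rightarrow> (real \<Rightarrow> R33) \<Rightarrow> (real \<times> real \<Rightarrow> R12) \<Rightarrow> bool" where
  "compat_eq T L C Rc y \<longleftrightarrow>
     (let v = upper \<circ> y; s = strain C y; \<Upsilon> = curv L Rc in
      \<forall>x\<in>{0<..<L}. \<forall>t\<in>{0<..<T}.
        dt T s (x, t) - dx L v (x, t)
          - block_matrix (hat (\<Upsilon> x)) (hat e1) 0 (hat (\<Upsilon> x)) *v v (x, t)
        = - (block_matrix (hat (lower (v (x, t)))) (hat (upper (v (x, t))))
                          0 (hat (lower (v (x, t)))) *v s (x, t)))"

definition initial_eq ::
  "real \<Rightarrow> (real \<Rightarrow> R66) \<Rightarrow> (real \<Rightarrow> R33) \<Rightarrow> (real \<Rightarrow> R3) \<Rightarrow> (real \<Rightarrow> R33) \<Rightarrow>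
   (real \<times> real \<Rightarrow> R12) \<Rightarrow> bool" where
  "initial_eq L C Rc p0 R0 y \<longleftrightarrow>
     (let s = strain C y; \<Upsilon> = curv L Rc in
      \<forall>x\<in>{0<..<L}.
        (p0 has_vector_derivative R0 x *v (upper (s (x, 0)) + e1)) (at x) \<and>
        (R0 has_vector_derivative R0 x ** (hat (lower (s (x, 0))) + hat (\<Upsilon> x))) (at x))"

definition boundary_eq ::
  "real \<Rightarrow> (real \<Rightarrow> R3) \<Rightarrow> (real \<Rightarrow> R33) \<Rightarrow> real \<Rightarrow> (real \<times> real \<Rightarrow> R12) \<Rightarrow> bool" where
  "boundary_eq T fp fR a y \<longleftrightarrow>
     (let v = upper \<circ> y in
      \<forall>t\<in>{0<..<T}.
        (fp has_vector_derivative fR t *v upper (v (a, t))) (at t) \<and>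
        (fR has_vector_derivative fR t ** hat (lower (v (a, t)))) (at t))"

definition E2 ::
  "('n, nat) pre_digraph \<Rightarrow> nat \<Rightarrow> 'n set \<Rightarrow> real \<Rightarrow> (nat \<Rightarrow> real) \<Rightarrow>
   (nat \<Rightarrow> real \<Rightarrow> R66) \<Rightarrow> (nat \<Rightarrow> real \<Rightarrow> R33) \<Rightarrow>
   (nat \<Rightarrow> real \<Rightarrow> R3) \<Rightarrow> (nat \<Rightarrow> real \<Rightarrow> R33) \<Rightarrow> ('n \<Rightarrow> real \<Rightarrow> R3) \<Rightarrow> ('n \<Rightarrow> real \<Rightarrow> R33) \<Rightarrow>
   (nat \<Rightarrow> real \<times> real \<Rightarrow> R12) set" where
  "E2 G N nodes_D T len C Rc p0 R0 fp fR =
     {y \<in> (\<Pi>\<^sub>E i\<in>{1..N}. C_space 1 ({0..len i} \<times> {0..T}) UNIV).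
        (\<forall>i\<in>{1..N}. compat_eq T (len i) (C i) (Rc i) (y i)) \<and>
        (\<forall>i\<in>{1..N}. initial_eq (len i) (C i) (Rc i) (p0 i) (R0 i) (y i)) \<and>
        (\<forall>n\<in>nodes_D. boundary_eq T (fp n) (fR n) (the_end G len n) (y (the_arc G n)))}"

end

theory Submission
  imports Defs
begin

text \<open>
  A beam state is a field of frames \<open>q = (p, R)\<close> on which \<open>se3\<close> acts bilinearly. The equation
  \<open>T_beam q = y\<close> says exactly that \<open>q\<close> solves the overdetermined linear system
  \<open>q_x = se3 q \<alpha>\<close>, \<open>q_t = se3 q \<beta>\<close>, where \<open>\<beta> = v\<close> and \<open>\<alpha> = s + (e\<^sub>1, \<Upsilon>)\<close>, and the
  compatibility equation defining \<open>E2\<close> is its integrability condition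
  \<open>\<alpha>_t - \<beta>_x = bracket \<alpha> \<beta>\<close>. Symmetry of mixed partial derivatives therefore puts the image in
  \<open>E2\<close>. Uniqueness for the linear equation in \<open>t\<close> gives injectivity and also identifies \<open>q\<close> with
  the Dirichlet data at a node, which solve the same equation; solvability of the integrable
  system with the given initial data gives surjectivity.
\<close>

section \<open>Calculus of continuously differentiable maps\<close>

text \<open>The beams do not interact here: both spaces impose their conditions edge by edge, so
  bijectivity is a statement about one beam at a time. An edge may carry Dirichlet data at both
  ends, and these cannot be prescribed on top of the initial frame, because that frame already fixes
  the solution. The node data are therefore recovered as traces; their agreement with the initial
  frame at \<open>t = 0\<close> starts the comparison.

  Three obstacles shape the rest. SO(3) is not a linear space: the system is solved among all pairs
  of a vector and a matrix, and membership in SO(3) is proved afterwards. The equations of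
  \<open>E2\<close> and the data of \<open>E1\<close> are given on open intervals only: all fields
  are continuous up to the boundary, so the identities are carried to the closed sets on which the
  equations are solved. Finally, the solution is obtained without differentiating in a parameter, so
  it starts out merely continuous and gains two derivatives from the equations themselves, as many
  as C^1 coefficients allow.\<close>

lemma C_diff_on_cong:
  assumes "\<And>x. x \<in> S \<Longrightarrow> f x = g x"
  shows "C_diff_on k S f \<longleftrightarrow> C_diff_on k S g"
proof (cases k)
  case 0
  then show ?thesis using assms by (simp cong: continuous_on_cong)
next
  case (Suc m)
  have "(f has_derivative D) (at x within S) \<longleftrightarrow> (g has_derivative D) (at x within S)"
    if "x \<in> S" for x D
    using has_derivative_transform[OF that, of f g] has_derivative_transform[OF that, of g f] assms
    by metis
  then show ?thesis using Suc by simp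
qed

lemma C_diff_on_imp_continuous_on: "C_diff_on k S f \<Longrightarrow> continuous_on S f"
  by (cases k) (auto intro: has_derivative_continuous_on)

lemma C_diff_on_SucD: "C_diff_on (Suc k) S f \<Longrightarrow> C_diff_on k S f"
proof (induction k arbitrary: f)
  case 0
  then show ?case using C_diff_on_imp_continuous_on[of "Suc 0"] by simp
next
  case (Suc k)
  then show ?case by (metis C_diff_on.simps(2))
qed

lemma C_diff_on_const: "C_diff_on k S (\<lambda>x. c)"
  by (induction k arbitrary: c) (auto intro!: exI[of _ "\<lambda>x h. 0"])

lemma C_diff_on_linear:
  assumes "bounded_linear g" "C_diff_on k S f"
  shows "C_diff_on k S (\<lambda>x. g (f x))"
  using assms(2)
proof (induction k arbitrary: f)
  case 0
  then show ?case by (simp add: bounded_linear.continuous_on[OF assms(1)])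
next
  case (Suc k)
  then obtain f' where "\<forall>x\<in>S. (f has_derivative f' x) (at x within S)"
      "\<forall>h. C_diff_on k S (\<lambda>x. f' x h)"
    by auto
  then show ?case using Suc.IH
    by (auto intro!: exI[of _ "\<lambda>x h. g (f' x h)"] bounded_linear.has_derivative[OF assms(1)])
qed

lemma C_diff_on_Pair:
  assumes "C_diff_on k S f" "C_diff_on k S g"
  shows "C_diff_on k S (\<lambda>x. (f x, g x))"
  using assms
proof (induction k arbitrary: f g)
  case 0
  then show ?case by (simp add: continuous_on_Pair)
next
  case (Suc k)
  then obtain f' g' where "\<forall>x\<in>S. (f has_derivative f' x) (at x within S)"
      "\<forall>h. C_diff_on k S (\<lambda>x. f' x h)" "\<forall>x\<in>S. (g has_derivative g' x) (at x within S)"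
      "\<forall>h. C_diff_on k S (\<lambda>x. g' x h)"
    by auto
  then show ?case using Suc.IH
    by (auto intro!: exI[of _ "\<lambda>x h. (f' x h, g' x h)"] has_derivative_Pair)
qed

lemma C_diff_on_add:
  assumes "C_diff_on k S f" "C_diff_on k S g"
  shows "C_diff_on k S (\<lambda>x. f x + g x)"
  using C_diff_on_linear[OF bounded_linear_add[OF bounded_linear_fst bounded_linear_snd]
      C_diff_on_Pair[OF assms]] by simp

lemma C_diff_on_diff:
  assumes "C_diff_on k S f" "C_diff_on k S g"
  shows "C_diff_on k S (\<lambda>x. f x - g x)"
  using C_diff_on_linear[OF bounded_linear_sub[OF bounded_linear_fst bounded_linear_snd]
      C_diff_on_Pair[OF assms]] by simp

lemma C_diff_on_sum:
  assumes "\<And>i. i \<in> I \<Longrightarrow> C_diff_on k S (f i)"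
  shows "C_diff_on k S (\<lambda>x. \<Sum>i\<in>I. f i x)"
  using assms by (induction I rule: infinite_finite_induct) (simp_all add: C_diff_on_const C_diff_on_add)

text \<open>The Leibniz rule pairs a derivative of one factor with the other factor
  undifferentiated, so the induction also uses that \<open>f\<close> and \<open>g\<close> themselves
  belong to the class of order \<open>k\<close>.\<close>

lemma C_diff_on_bilinear:
  assumes "bounded_bilinear m" "C_diff_on k S f" "C_diff_on k S g"
  shows "C_diff_on k S (\<lambda>x. m (f x) (g x))"
  using assms(2,3)
proof (induction k arbitrary: f g)
  case 0
  then show ?case by (simp add: bounded_bilinear.continuous_on[OF assms(1)])
next
  case (Suc k)
  obtain f' g' where f': "\<forall>x\<in>S. (f has_derivative f' x) (at x within S)"
      "\<forall>h. C_diff_on k S (\<lambda>x. f' x h)" and g': "\<forall>x\<in>S. (g has_derivative g' x) (at x within S)"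
      "\<forall>h. C_diff_on k S (\<lambda>x. g' x h)"
    using Suc.prems by auto
  have "C_diff_on k S f" "C_diff_on k S g"
    using Suc.prems C_diff_on_SucD by blast+
  with f' g' show ?case
    by (auto intro!: exI[of _ "\<lambda>x h. m (f x) (g' x h) + m (f' x h) (g x)"] C_diff_on_add Suc.IH
        bounded_bilinear.FDERIV[OF assms(1)])
qed

lemmas C_diff_on_mult = C_diff_on_bilinear[OF bounded_bilinear_mult]

lemma C_diff_on_prod:
  fixes f :: "'i \<Rightarrow> 'a::real_normed_vector \<Rightarrow> real"
  assumes "\<And>i. i \<in> I \<Longrightarrow> C_diff_on k S (f i)"
  shows "C_diff_on k S (\<lambda>x. \<Prod>i\<in>I. f i x)"
  using assms by (induction I rule: infinite_finite_induct) (simp_all add: C_diff_on_const C_diff_on_mult)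

text \<open>The derivative of \<open>1/f\<close> contains \<open>1/f\<close> again, so the claim at
  order \<open>k\<close> for \<open>1/f\<close> itself feeds the product that forms its
  derivative.\<close>

lemma C_diff_on_inverse:
  fixes f :: "'a::real_normed_vector \<Rightarrow> real"
  assumes "C_diff_on k S f" "\<And>x. x \<in> S \<Longrightarrow> f x \<noteq> 0"
  shows "C_diff_on k S (\<lambda>x. inverse (f x))"
  using assms
proof (induction k)
  case 0
  then show ?case by (simp add: continuous_on_inverse)
next
  case (Suc k)
  then obtain f' where f': "\<forall>x\<in>S. (f has_derivative f' x) (at x within S)"
      "\<forall>h. C_diff_on k S (\<lambda>x. f' x h)"
    by auto
  have inv: "C_diff_on k S (\<lambda>x. inverse (f x))"
    using Suc C_diff_on_SucD by blast
  with f' Suc.prems(2) show ?case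
    by (auto intro!: exI[of _ "\<lambda>x h. - (inverse (f x) * f' x h * inverse (f x))"] has_derivative_inverse
        C_diff_on_mult C_diff_on_linear[OF bounded_linear_minus[OF bounded_linear_ident]])
qed

text \<open>For a linear inner map the chain rule gives the direction \<open>g h\<close>, which does
  not depend on the base point, so the derivative in direction \<open>h\<close> is again of the form
  treated by the induction.\<close>

lemma C_diff_on_compose_linear:
  assumes g: "bounded_linear g" and "g ` S \<subseteq> S'" and "C_diff_on k S' f"
  shows "C_diff_on k S (\<lambda>x. f (g x))"
  using assms(3)
proof (induction k arbitrary: f)
  case 0
  have "continuous_on S g" by (simp add: linear_continuous_on g)
  then show ?case using 0 assms(2) continuous_on_compose2 by auto
next
  case (Suc k)
  then obtain f' where f': "\<forall>x\<in>S'. (f has_derivative f' x) (at x within S')"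
      "\<forall>h. C_diff_on k S' (\<lambda>x. f' x h)"
    by auto
  have "((\<lambda>x. f (g x)) has_derivative (\<lambda>h. f' (g x) (g h))) (at x within S)" if "x \<in> S" for x
    using f'(1) that assms(2)
    by (intro has_derivative_in_compose2[of S' f "\<lambda>x. f' x" g S x])
       (auto simp: bounded_linear_imp_has_derivative[OF g])
  with f' Suc.IH show ?case
    by (auto intro!: exI[of _ "\<lambda>x h. f' (g x) (g h)"])
qed

lemma C_diff_on_compose_fst:
  "C_diff_on k A f \<Longrightarrow> C_diff_on k (A \<times> B) (\<lambda>w. f (fst w))"
  by (rule C_diff_on_compose_linear[OF bounded_linear_fst]) auto

lemma C_diff_on_vec:
  fixes f :: "'i::finite \<Rightarrow> 'a::real_normed_vector \<Rightarrow> real"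
  assumes "\<And>i. C_diff_on k S (f i)"
  shows "C_diff_on k S (\<lambda>x. \<chi> i. f i x)"
proof -
  have eq: "(\<chi> i. f i x) = (\<Sum>i\<in>UNIV. f i x *\<^sub>R axis i 1)" for x
    by (simp add: vec_eq_iff axis_def if_distrib cong: if_cong)
  show ?thesis unfolding eq
    by (intro C_diff_on_sum C_diff_on_linear[OF bounded_linear_scaleR_left] assms)
qed

section \<open>Regularity of the inverse of a matrix\<close>

lemma C_diff_on_det:
  fixes A :: "'a::real_normed_vector \<Rightarrow> real ^ 'n ^ 'n"
  assumes "\<And>i j. C_diff_on k S (\<lambda>x. A x $ i $ j)"
  shows "C_diff_on k S (\<lambda>x. det (A x))"
  unfolding det_def by (intro C_diff_on_sum C_diff_on_mult C_diff_on_const C_diff_on_prod assms)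

lemma invertible_matrix_inv:
  fixes A :: "real ^ 'n ^ 'n"
  assumes "invertible A"
  shows "A ** matrix_inv A = mat 1" "matrix_inv A ** A = mat 1"
  using someI_ex[OF assms[unfolded invertible_def]] by (simp_all add: matrix_inv_def)

lemma matrix_inv_cramer:
  fixes A :: "real ^ 'n ^ 'n"
  assumes "invertible A"
  shows "matrix_inv A *v b = (\<chi> k. det (\<chi> i j. if j = k then b $ i else A $ i $ j) / det A)"
proof -
  have "A *v (matrix_inv A *v b) = b"
    by (simp add: matrix_vector_mul_assoc invertible_matrix_inv(1) assms)
  then show ?thesis
    using cramer[of A "matrix_inv A *v b" b] assms invertible_det_nz[of A] by blast
qed

text \<open>Cramer's rule writes every component as a quotient of determinants, which are
  polynomials in the entries of \<open>A\<close> and \<open>b\<close>. The lemma serves the factor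
  \<open>matrix_inv (C x)\<close> in \<open>stress\<close>.\<close>

lemma C_diff_on_matrix_inv_mult:
  fixes A :: "'a::real_normed_vector \<Rightarrow> real ^ 'n ^ 'n"
  assumes A: "C_diff_on k S A" and b: "C_diff_on k S b" and inv: "\<And>x. x \<in> S \<Longrightarrow> invertible (A x)"
  shows "C_diff_on k S (\<lambda>x. matrix_inv (A x) *v b x)"
proof -
  have comp: "C_diff_on k S (\<lambda>x. A x $ i $ j)" "C_diff_on k S (\<lambda>x. b x $ i)" for i j
    by (intro C_diff_on_linear[OF bounded_linear_vec_nth] A b)+
  have "C_diff_on k S (\<lambda>x. (if j = m then b x $ i else A x $ i $ j))" for i j m
    using comp by (cases "j = m") simp_all
  then have "C_diff_on k S (\<lambda>x. \<chi> m. det (\<chi> i j. if j = m then b x $ i else A x $ i $ j) * inverse (det (A x)))"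
    using inv
    by (intro C_diff_on_vec C_diff_on_mult C_diff_on_det C_diff_on_inverse)
       (auto simp: comp invertible_det_nz)
  then show ?thesis
    by (rule C_diff_on_cong[THEN iffD1, rotated]) (simp add: matrix_inv_cramer inv divide_inverse)
qed

text \<open>\<open>vector_derivative\<close> picks some derivative; \<open>L > 0\<close> makes the
  one within \<open>{0..L}\<close> unique, at the endpoints too.\<close>

lemma dx_eqI:
  fixes f :: "real \<times> real \<Rightarrow> 'b::real_normed_vector"
  assumes "L > 0" "x \<in> {0..L}" "((\<lambda>\<xi>. f (\<xi>, t)) has_vector_derivative D) (at x within {0..L})"
  shows "dx L f (x, t) = D"
  using vector_derivative_within_cbox[of 0 L x] assms by (auto simp: dx_def)

lemma dt_eqI:
  fixes f :: "real \<times> real \<Rightarrow> 'b::real_normed_vector"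
  assumes "T > 0" "t \<in> {0..T}" "((\<lambda>\<tau>. f (x, \<tau>)) has_vector_derivative D) (at t within {0..T})"
  shows "dt T f (x, t) = D"
  using vector_derivative_within_cbox[of 0 T t] assms by (auto simp: dt_def)

text \<open>The partial derivatives are the values of the derivative within the rectangle on
  \<open>(1, 0)\<close> and \<open>(0, 1)\<close>, by the chain rule along horizontal and vertical
  segments, which stay in the rectangle.\<close>

lemma C_diff_on_partials:
  fixes f :: "real \<times> real \<Rightarrow> 'b::real_normed_vector"
  assumes L: "L > 0" and T: "T > 0" and f: "C_diff_on (Suc k) ({0..L} \<times> {0..T}) f"
  shows "C_diff_on k ({0..L} \<times> {0..T}) (dx L f)"
    and "C_diff_on k ({0..L} \<times> {0..T}) (dt T f)"
    and "\<And>x t. x \<in> {0..L} \<Longrightarrow> t \<in> {0..T} \<Longrightarrow>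
          ((\<lambda>\<xi>. f (\<xi>, t)) has_vector_derivative dx L f (x, t)) (at x within {0..L})"
    and "\<And>x t. x \<in> {0..L} \<Longrightarrow> t \<in> {0..T} \<Longrightarrow>
          ((\<lambda>\<tau>. f (x, \<tau>)) has_vector_derivative dt T f (x, t)) (at t within {0..T})"
proof -
  let ?S = "{0..L} \<times> {0..T}"
  obtain f' where f': "\<And>w. w \<in> ?S \<Longrightarrow> (f has_derivative f' w) (at w within ?S)"
      "\<And>h. C_diff_on k ?S (\<lambda>w. f' w h)"
    using f by auto
  have lin: "f' w (h *\<^sub>R z) = h *\<^sub>R f' w z" if "w \<in> ?S" for w h z
    using f'(1)[OF that] has_derivative_bounded_linear bounded_linear.linear linear_scale by blast
  have X: "((\<lambda>\<xi>. f (\<xi>, t)) has_vector_derivative f' (x, t) (1, 0)) (at x within {0..L})"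
    if "x \<in> {0..L}" "t \<in> {0..T}" for x t
  proof -
    have "((\<lambda>\<xi>. f (\<xi>, t)) has_derivative (\<lambda>h. f' (x, t) (h, 0))) (at x within {0..L})"
      using that f'(1)
      by (intro has_derivative_in_compose2[of ?S f f' "\<lambda>\<xi>. (\<xi>, t)"]
          has_derivative_Pair has_derivative_ident has_derivative_const) auto
    moreover have "f' (x, t) (h, 0) = h *\<^sub>R f' (x, t) (1, 0)" for h
      using lin[of "(x, t)" h "(1, 0)"] that by simp
    ultimately show ?thesis unfolding has_vector_derivative_def
      by (elim has_derivative_eq_rhs) (rule ext)
  qed
  have Y: "((\<lambda>\<tau>. f (x, \<tau>)) has_vector_derivative f' (x, t) (0, 1)) (at t within {0..T})"
    if "x \<in> {0..L}" "t \<in> {0..T}" for x t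
  proof -
    have "((\<lambda>\<tau>. f (x, \<tau>)) has_derivative (\<lambda>h. f' (x, t) (0, h))) (at t within {0..T})"
      using that f'(1)
      by (intro has_derivative_in_compose2[of ?S f f' "\<lambda>\<tau>. (x, \<tau>)"]
          has_derivative_Pair has_derivative_ident has_derivative_const) auto
    moreover have "f' (x, t) (0, h) = h *\<^sub>R f' (x, t) (0, 1)" for h
      using lin[of "(x, t)" h "(0, 1)"] that by simp
    ultimately show ?thesis unfolding has_vector_derivative_def
      by (elim has_derivative_eq_rhs) (rule ext)
  qed
  have dx: "dx L f w = f' w (1, 0)" and dt: "dt T f w = f' w (0, 1)" if "w \<in> ?S" for w
  proof -
    obtain x t where w: "w = (x, t)" and xt: "x \<in> {0..L}" "t \<in> {0..T}"
      using \<open>w \<in> ?S\<close> by blast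
    show "dx L f w = f' w (1, 0)" "dt T f w = f' w (0, 1)"
      unfolding w by (rule dx_eqI[OF L xt(1) X[OF xt]] dt_eqI[OF T xt(2) Y[OF xt]])+
  qed
  show "C_diff_on k ?S (dx L f)"
    by (rule C_diff_on_cong[THEN iffD2, OF dx f'(2)])
  show "C_diff_on k ?S (dt T f)"
    by (rule C_diff_on_cong[THEN iffD2, OF dt f'(2)])
  show "((\<lambda>\<xi>. f (\<xi>, t)) has_vector_derivative dx L f (x, t)) (at x within {0..L})"
    if "x \<in> {0..L}" "t \<in> {0..T}" for x t
    by (subst dx) (use X[OF that] that in simp_all)
  show "((\<lambda>\<tau>. f (x, \<tau>)) has_vector_derivative dt T f (x, t)) (at t within {0..T})"
    if "x \<in> {0..L}" "t \<in> {0..T}" for x t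
    by (subst dt) (use Y[OF that] that in simp_all)
qed

text \<open>Partial derivatives give a full derivative once one of them is continuous in both
  variables; here it is \<open>ft\<close>, put in the form of a bounded linear function. Applied to
  a solution of the frame equations, the lemma turns the regularity of the right-hand sides into one
  more order for the solution.\<close>

lemma C_diff_on_SucI_partials:
  fixes f :: "real \<times> real \<Rightarrow> 'b::real_normed_vector"
  assumes fx: "\<And>x t. x \<in> {0..L} \<Longrightarrow> t \<in> {0..T} \<Longrightarrow>
      ((\<lambda>\<xi>. f (\<xi>, t)) has_vector_derivative fx (x, t)) (at x within {0..L})"
    and ft: "\<And>x t. x \<in> {0..L} \<Longrightarrow> t \<in> {0..T} \<Longrightarrow>
      ((\<lambda>\<tau>. f (x, \<tau>)) has_vector_derivative ft (x, t)) (at t within {0..T})"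
    and C: "C_diff_on k ({0..L} \<times> {0..T}) fx" "C_diff_on k ({0..L} \<times> {0..T}) ft"
  shows "C_diff_on (Suc k) ({0..L} \<times> {0..T}) f"
proof -
  let ?S = "{0..L} \<times> {0..T}"
  have cont: "continuous_on ?S (\<lambda>(x, t). blinfun_scaleR_left (ft (x, t)))"
    unfolding split_def prod.collapse using bounded_linear.continuous_on[OF bounded_linear_blinfun_scaleR_left]
      C_diff_on_imp_continuous_on C(2) by blast
  have "(f has_derivative (\<lambda>h. fst h *\<^sub>R fx w + snd h *\<^sub>R ft w)) (at w within ?S)"
    if "w \<in> ?S" for w
  proof -
    obtain x t where w: "w = (x, t)" and xt: "x \<in> {0..L}" "t \<in> {0..T}" using \<open>w \<in> ?S\<close> by blast
    have "((\<lambda>(x, t). f (x, t)) has_derivative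
        (\<lambda>(h, k). h *\<^sub>R fx (x, t) + blinfun_apply (blinfun_scaleR_left (ft (x, t))) k)) (at (x, t) within ?S)"
      using fx[OF xt] ft xt cont unfolding has_vector_derivative_def
      by (intro has_derivative_partialsI)
         (auto simp: continuous_on_eq_continuous_within split_def)
    then show ?thesis by (simp add: w split_def)
  qed
  moreover have "C_diff_on k ?S (\<lambda>w. fst h *\<^sub>R fx w + snd h *\<^sub>R ft w)" for h
    by (intro C_diff_on_add C_diff_on_linear[OF bounded_linear_scaleR_right] C)
  ultimately show ?thesis
    by (auto intro!: exI[of _ "\<lambda>w h. fst h *\<^sub>R fx w + snd h *\<^sub>R ft w"])
qed

text \<open>The identity must hold on the edges of the rectangle, where derivatives are one-sided,
  so it is obtained by integration: \<open>f\<close> is its value at \<open>x = 0\<close> plus the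
  integral of \<open>dx L f\<close>, the time derivative passes under the integral, and
  differentiating the outcome in \<open>x\<close> returns the integrand
  \<open>dt T (dx L f)\<close>.\<close>

lemma C2_mixed_partials_eq:
  fixes f :: "real \<times> real \<Rightarrow> 'b::banach"
  assumes L: "L > 0" and T: "T > 0" and f: "C_diff_on (Suc (Suc 0)) ({0..L} \<times> {0..T}) f"
    and xt: "x \<in> {0..L}" "t \<in> {0..T}"
  shows "dt T (dx L f) (x, t) = dx L (dt T f) (x, t)"
proof -
  let ?S = "{0..L} \<times> {0..T}"
  note 1 = C_diff_on_partials[OF L T f]
  note X = C_diff_on_partials[OF L T 1(1)] and Y = C_diff_on_partials[OF L T 1(2)]
  have cX: "continuous_on ?S (dx L f)" and cXT: "continuous_on ?S (dt T (dx L f))"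
    using 1(1) X(2) C_diff_on_imp_continuous_on by blast+
  have row: "continuous_on {0..\<xi>} (\<lambda>\<eta>. g (\<eta>, \<tau>))"
    if "continuous_on ?S g" "\<xi> \<in> {0..L}" "\<tau> \<in> {0..T}" for g :: "real \<times> real \<Rightarrow> 'b" and \<xi> \<tau>
    using that by (auto intro!: continuous_on_compose2[OF that(1)] continuous_intros)
  have ftc: "f (\<xi>, \<tau>) = f (0, \<tau>) + integral {0..\<xi>} (\<lambda>\<eta>. dx L f (\<eta>, \<tau>))"
    if "\<xi> \<in> {0..L}" "\<tau> \<in> {0..T}" for \<xi> \<tau>
  proof -
    have "((\<lambda>\<eta>. dx L f (\<eta>, \<tau>)) has_integral (f (\<xi>, \<tau>) - f (0, \<tau>))) {0..\<xi>}"
      using that by (intro fundamental_theorem_of_calculus)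
        (auto intro!: has_vector_derivative_within_subset[OF 1(3)])
    then show ?thesis by (simp add: integral_unique)
  qed
  have T1: "dt T f (\<xi>, t) = dt T f (0, t) + integral {0..\<xi>} (\<lambda>\<eta>. dt T (dx L f) (\<eta>, t))"
    if "\<xi> \<in> {0..L}" for \<xi>
  proof (rule dt_eqI[OF T xt(2)])
    have "((\<lambda>\<tau>. integral (cbox 0 \<xi>) (\<lambda>\<eta>. dx L f (\<eta>, \<tau>))) has_vector_derivative
        integral (cbox 0 \<xi>) (\<lambda>\<eta>. dt T (dx L f) (\<eta>, t))) (at t within {0..T})"
    proof (rule leibniz_rule_vector_derivative)
      show "continuous_on ({0..T} \<times> cbox 0 \<xi>) (\<lambda>(\<tau>, \<eta>). dt T (dx L f) (\<eta>, \<tau>))"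
        using that unfolding split_beta
        by (intro continuous_on_compose2[OF cXT]) (auto intro!: continuous_intros)
      show "(\<lambda>\<eta>. dx L f (\<eta>, \<tau>)) integrable_on cbox 0 \<xi>" if "\<tau> \<in> {0..T}" for \<tau>
        using row[OF cX \<open>\<xi> \<in> {0..L}\<close> that] by (simp add: integrable_continuous_real)
      show "((\<lambda>\<tau>. dx L f (\<eta>, \<tau>)) has_vector_derivative dt T (dx L f) (\<eta>, \<tau>)) (at \<tau> within {0..T})"
        if "\<tau> \<in> {0..T}" "\<eta> \<in> cbox 0 \<xi>" for \<tau> \<eta>
        using X(4) that \<open>\<xi> \<in> {0..L}\<close> by auto
    qed (use xt in auto)
    then have "((\<lambda>\<tau>. f (0, \<tau>) + integral {0..\<xi>} (\<lambda>\<eta>. dx L f (\<eta>, \<tau>))) has_vector_derivative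
        dt T f (0, t) + integral {0..\<xi>} (\<lambda>\<eta>. dt T (dx L f) (\<eta>, t))) (at t within {0..T})"
      using L xt by (intro has_vector_derivative_add 1(4)) auto
    then show "((\<lambda>\<tau>. f (\<xi>, \<tau>)) has_vector_derivative
        dt T f (0, t) + integral {0..\<xi>} (\<lambda>\<eta>. dt T (dx L f) (\<eta>, t))) (at t within {0..T})"
      by (rule has_vector_derivative_transform[OF xt(2), rotated]) (rule ftc[OF that])
  qed
  have "((\<lambda>\<xi>. dt T f (0, t) + integral {0..\<xi>} (\<lambda>\<eta>. dt T (dx L f) (\<eta>, t))) has_vector_derivative
      0 + dt T (dx L f) (x, t)) (at x within {0..L})"
    using L xt by (intro has_vector_derivative_add has_vector_derivative_const
        integral_has_vector_derivative[where f="\<lambda>\<eta>. dt T (dx L f) (\<eta>, t)"] row[OF cXT]) auto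
  then have "((\<lambda>\<xi>. dt T f (\<xi>, t)) has_vector_derivative dt T (dx L f) (x, t)) (at x within {0..L})"
    using has_vector_derivative_transform[OF xt(1) T1] by simp
  then show ?thesis by (rule dx_eqI[OF L xt(1), symmetric])
qed

section \<open>Integrable overdetermined linear systems\<close>

lemma continuous_on_compact_norm_bound:
  fixes f :: "'a::topological_space \<Rightarrow> 'b::real_normed_vector"
  assumes "continuous_on S f" "compact S"
  obtains c where "c > 0" "\<And>x. x \<in> S \<Longrightarrow> norm (f x) \<le> c"
  using compact_imp_bounded[OF compact_continuous_image[OF assms]] unfolding bounded_pos by blast

text \<open>The squared norm is differentiable also where \<open>E\<close> vanishes, so the estimate
  runs on it. What matters later is the linear dependence on \<open>norm (E 0) + r\<close>; the
  factor in front is deliberately crude.\<close>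

lemma gronwall:
  fixes E :: "real \<Rightarrow> 'a::real_inner"
  assumes deriv: "\<And>s. s \<in> {0..T} \<Longrightarrow> (E has_vector_derivative E' s) (at s within {0..T})"
    and bound: "\<And>s. s \<in> {0..T} \<Longrightarrow> norm (E' s) \<le> M * norm (E s) + r"
    and M: "M \<ge> 0" and r: "r \<ge> 0" and t: "t \<in> {0..T}"
  shows "norm (E t) \<le> (1 + T) * exp ((2 * M + 1) * T) * (norm (E 0) + r)"
proof -
  \<comment> \<open>The term \<open>2 * M\<close> absorbs the linear part of the bound, and the
    extra \<open>1\<close> absorbs the square of \<open>norm (E s)\<close> that arises when
    \<open>2 * r * norm (E s)\<close> is split into two squares. The summand with \<open>r\<close>
    in \<open>g\<close> compensates the other square, so \<open>g\<close> is nonincreasing.\<close>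
  define c where "c = 2 * M + 1"
  define g where "g = (\<lambda>s. (E s \<bullet> E s) * exp (- c * s) - r\<^sup>2 * s)"
  define g' where "g' = (\<lambda>s. (E s \<bullet> E' s + E' s \<bullet> E s) * exp (- c * s)
      + (- c * exp (- c * s)) * (E s \<bullet> E s) - r\<^sup>2)"
  have Tnn: "T \<ge> 0" and c: "c \<ge> 1" using t M by (auto simp: c_def)
  have g_deriv: "(g has_real_derivative g' s) (at s within {0..T})" if "s \<in> {0..T}" for s
  proof -
    have "((\<lambda>s. E s \<bullet> E s) has_real_derivative E s \<bullet> E' s + E' s \<bullet> E s) (at s within {0..T})"
      unfolding has_real_derivative_iff_has_vector_derivative
      by (rule bounded_bilinear.has_vector_derivative[OF bounded_bilinear_inner deriv[OF that] deriv[OF that]])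
    then show ?thesis unfolding g_def g'_def
      by (auto intro!: derivative_eq_intros simp: algebra_simps)
  qed
  have "g' s \<le> 0" if s: "s \<in> {0..T}" for s
  proof -
    have "E s \<bullet> E' s \<le> norm (E s) * norm (E' s)" by (rule norm_cauchy_schwarz)
    also have "\<dots> \<le> norm (E s) * (M * norm (E s) + r)"
      by (rule mult_left_mono[OF bound[OF s]]) simp
    finally have "2 * (E s \<bullet> E' s) \<le> 2 * M * (norm (E s))\<^sup>2 + 2 * r * norm (E s)"
      by (simp add: algebra_simps power2_eq_square)
    moreover have "2 * r * norm (E s) \<le> r\<^sup>2 + (norm (E s))\<^sup>2"
      using sum_squares_bound[of r "norm (E s)"] by simp
    ultimately have "2 * (E s \<bullet> E' s) - c * (E s \<bullet> E s) \<le> r\<^sup>2"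
      by (simp add: c_def algebra_simps power2_norm_eq_inner)
    then have "(2 * (E s \<bullet> E' s) - c * (E s \<bullet> E s)) * exp (- c * s) \<le> r\<^sup>2 * exp (- c * s)"
      by (rule mult_right_mono) simp
    also have "\<dots> \<le> r\<^sup>2 * 1"
      using s c by (intro mult_left_mono) auto
    finally show ?thesis
      by (simp add: g'_def inner_commute algebra_simps)
  qed
  then have "g t \<le> g 0"
    using t g_deriv
    by (intro DERIV_nonpos_imp_decreasing_open[of 0 t g] exI[of _ "g' _"] conjI)
       (auto intro!: has_real_derivative_imp_continuous_on DERIV_continuous_on
          DERIV_subset[OF g_deriv] simp flip: at_within_Icc_at[of 0 _ T])
  then have "(norm (E t))\<^sup>2 * exp (- c * t) \<le> (norm (E 0))\<^sup>2 + r\<^sup>2 * t"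
    by (simp add: g_def power2_norm_eq_inner)
  then have "(norm (E t))\<^sup>2 \<le> ((norm (E 0))\<^sup>2 + r\<^sup>2 * t) * exp (c * t)"
    by (simp add: exp_minus field_simps)
  also have "\<dots> \<le> ((1 + T) * (norm (E 0) + r)\<^sup>2) * exp (c * T)"
  proof (intro mult_mono)
    have "r\<^sup>2 * t \<le> r\<^sup>2 * T" using t by (intro mult_left_mono) auto
    then have "(norm (E 0))\<^sup>2 + r\<^sup>2 * t \<le> (norm (E 0))\<^sup>2 + r\<^sup>2 * T + (r\<^sup>2 + T * (norm (E 0))\<^sup>2)"
      using mult_nonneg_nonneg[OF Tnn zero_le_power2[of "norm (E 0)"]] zero_le_power2[of r] by linarith
    also have "\<dots> = (1 + T) * ((norm (E 0))\<^sup>2 + r\<^sup>2)"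
      by (simp add: algebra_simps)
    also have "\<dots> \<le> (1 + T) * (norm (E 0) + r)\<^sup>2"
      using Tnn r by (intro mult_left_mono) (auto simp: power2_sum)
    finally show "(norm (E 0))\<^sup>2 + r\<^sup>2 * t \<le> (1 + T) * (norm (E 0) + r)\<^sup>2" .
  qed (use t c Tnn in auto)
  \<comment> \<open>The surplus factors \<open>1 + T\<close> and \<open>exp (c * T)\<close>, both at
    least 1, complete a square, so that the root can be taken without roots of the
    constants.\<close>
  also have "\<dots> \<le> ((1 + T) * (1 + T) * (norm (E 0) + r)\<^sup>2) * (exp (c * T) * exp (c * T))"
    using Tnn c by (intro mult_mono) (auto simp: mult_le_cancel_right1)
  also have "\<dots> = ((1 + T) * exp (c * T) * (norm (E 0) + r))\<^sup>2"
    by (simp add: power2_eq_square algebra_simps)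
  finally show ?thesis
    using Tnn r unfolding c_def by (rule_tac power2_le_imp_le) auto
qed

section \<open>Linear ordinary differential equations\<close>

lemma linear_ode_unique:
  fixes u v :: "real \<Rightarrow> 'a::real_inner"
  assumes m: "bounded_bilinear m" and B: "continuous_on {0..T} B"
    and u: "\<And>t. t \<in> {0..T} \<Longrightarrow> (u has_vector_derivative m (u t) (B t)) (at t within {0..T})"
    and v: "\<And>t. t \<in> {0..T} \<Longrightarrow> (v has_vector_derivative m (v t) (B t)) (at t within {0..T})"
    and init: "u 0 = v 0" and t: "t \<in> {0..T}"
  shows "u t = v t"
proof -
  interpret bounded_bilinear m by (rule m)
  obtain K where K: "K > 0" "\<And>a b. norm (m a b) \<le> norm a * norm b * K"
    using pos_bounded by blast
  obtain c where "c > 0" and c: "\<And>t. t \<in> {0..T} \<Longrightarrow> norm (B t) \<le> c"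
    using continuous_on_compact_norm_bound[OF B compact_Icc] by blast
  have "norm (u t - v t) \<le> (1 + T) * exp ((2 * (c * K) + 1) * T) * (norm (u 0 - v 0) + 0)"
  proof (rule gronwall[where E' = "\<lambda>s. m (u s) (B s) - m (v s) (B s)", OF _ _ _ _ t])
    fix s assume s: "s \<in> {0..T}"
    show "((\<lambda>s. u s - v s) has_vector_derivative m (u s) (B s) - m (v s) (B s)) (at s within {0..T})"
      by (rule has_vector_derivative_diff[OF u[OF s] v[OF s]])
    have "norm (m (u s - v s) (B s)) \<le> norm (u s - v s) * norm (B s) * K" by (rule K)
    also have "\<dots> \<le> norm (u s - v s) * c * K"
      using c[OF s] K(1) by (intro mult_right_mono mult_left_mono) auto
    finally show "norm (m (u s) (B s) - m (v s) (B s)) \<le> c * K * norm (u s - v s) + 0"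
      by (simp add: diff_left mult.commute mult.left_commute)
  qed (use K \<open>c > 0\<close> in auto)
  then show ?thesis using init by simp
qed

text \<open>Picard iteration, organised as a series: \<open>U k\<close> is a \<open>k\<close>-fold
  iterated integral, and the partial sums are the Picard iterates. The factorial in the bound of
  \<open>U k\<close> makes the series converge on the whole interval, whatever its length. For
  \<open>T < 0\<close> only the initial value is asked for.\<close>

lemma linear_ode_exists:
  fixes m :: "'a::banach \<Rightarrow> 'b::real_normed_vector \<Rightarrow> 'a"
  assumes m: "bounded_bilinear m" and B: "continuous_on {0..T} B"
  shows "\<exists>u. u 0 = a \<and>
    (\<forall>t\<in>{0..T}. (u has_vector_derivative m (u t) (B t)) (at t within {0..T}))"
proof (cases "T \<ge> 0")
  case False
  then show ?thesis by auto
next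
  case T: True
  interpret bounded_bilinear m by (rule m)
  obtain K where K: "K > 0" "\<And>a b. norm (m a b) \<le> norm a * norm b * K"
    using pos_bounded by blast
  obtain c where "c > 0" and c: "\<And>t. t \<in> {0..T} \<Longrightarrow> norm (B t) \<le> c"
    using continuous_on_compact_norm_bound[OF B compact_Icc] by blast
  define M where "M = c * K"
  have M: "M \<ge> 0" using K \<open>c > 0\<close> by (simp add: M_def)
  have mB: "norm (m z (B t)) \<le> M * norm z" if "t \<in> {0..T}" for z t
  proof -
    have "norm (m z (B t)) \<le> norm z * norm (B t) * K" by (rule K)
    also have "\<dots> \<le> norm z * c * K"
      using c[OF that] K(1) by (intro mult_right_mono mult_left_mono) auto
    finally show ?thesis by (simp add: M_def mult.commute mult.left_commute)
  qed
  define U where "U = rec_nat (\<lambda>_. a) (\<lambda>_ V t. integral {0..t} (\<lambda>\<tau>. m (V \<tau>) (B \<tau>)))"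
  have U_0: "U 0 = (\<lambda>_. a)"
    and U_Suc: "U (Suc k) = (\<lambda>t. integral {0..t} (\<lambda>\<tau>. m (U k \<tau>) (B \<tau>)))" for k
    by (simp_all add: U_def)
  have U_deriv_if: "(U (Suc k) has_vector_derivative m (U k t) (B t)) (at t within {0..T})"
    if "t \<in> {0..T}" "continuous_on {0..T} (U k)" for k t
    unfolding U_Suc using that B
    by (intro integral_has_vector_derivative[where f="\<lambda>\<tau>. m (U k \<tau>) (B \<tau>)"] continuous_on) auto
  have U_cont: "continuous_on {0..T} (U k)" for k
  proof (induction k)
    case 0
    then show ?case by (simp add: U_0)
  next
    case (Suc k)
    then show ?case using U_deriv_if
      by (meson continuous_on_eq_continuous_within has_vector_derivative_continuous)
  qed
  note U_deriv = U_deriv_if[OF _ U_cont]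
  have U_bound: "norm (U k t) \<le> norm a * (M * t) ^ k / fact k" if "t \<in> {0..T}" for k t
    using that
  proof (induction k arbitrary: t)
    case 0
    then show ?case by (simp add: U_0)
  next
    case (Suc k)
    \<comment> \<open>The derivative of the majorant \<open>\<phi>\<close> dominates that of
      \<open>U (Suc k)\<close>, so the mean value inequality turns the bound for \<open>U k\<close>
      into the one for \<open>U (Suc k)\<close>.\<close>
    define \<phi> where "\<phi> = (\<lambda>s. norm a * (M * s) ^ Suc k / fact (Suc k))"
    show ?case
    proof (cases "t = 0")
      case True
      then show ?thesis by (simp add: U_Suc)
    next
      case False
      have "norm (U (Suc k) t - U (Suc k) 0) \<le> \<phi> t - \<phi> 0"
      proof (rule differentiable_bound_general)
        show "0 < t" using False Suc.prems by simp
        show "continuous_on {0..t} (U (Suc k))"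
          using Suc.prems by (intro continuous_on_subset[OF U_cont]) auto
        show "continuous_on {0..t} \<phi>" by (auto simp: \<phi>_def intro!: continuous_intros)
        fix s assume s: "0 < s" "s < t"
        then show "(U (Suc k) has_vector_derivative m (U k s) (B s)) (at s)"
          using U_deriv[of s k] Suc.prems at_within_Icc_at[of 0 s T] by auto
        have "(\<phi> has_real_derivative
            norm a * (real (Suc k) * (M * s) ^ k * M) / fact (Suc k)) (at s)"
          unfolding \<phi>_def by (auto intro!: derivative_eq_intros simp del: power_Suc)
        then show "(\<phi> has_vector_derivative norm a * (M * s) ^ k * M / fact k) (at s)"
          unfolding has_real_derivative_iff_has_vector_derivative
          by (simp add: field_simps del: of_nat_Suc)
        have "norm (m (U k s) (B s)) \<le> M * norm (U k s)" using s Suc.prems by (intro mB) auto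
        also have "\<dots> \<le> M * (norm a * (M * s) ^ k / fact k)"
          using s Suc M by (intro mult_left_mono) auto
        finally show "norm (m (U k s) (B s)) \<le> norm a * (M * s) ^ k * M / fact k"
          by (simp add: mult.commute mult.left_commute)
      qed
      then show ?thesis by (simp add: \<phi>_def U_Suc)
    qed
  qed
  define u where "u = (\<lambda>t. \<Sum>k. U k t)"
  have lim: "uniform_limit {0..T} (\<lambda>n t. \<Sum>k<n. U k t) u sequentially"
    unfolding u_def
  proof (rule Weierstrass_m_test)
    show "summable (\<lambda>k. norm a * ((M * T) ^ k / fact k))"
      using summable_exp[of "M * T"] by (intro summable_mult) (simp add: divide_inverse mult.commute)
    fix k t assume t: "t \<in> {0..T}"
    have "(M * t) ^ k \<le> (M * T) ^ k" using t M by (intro power_mono mult_left_mono) auto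
    then have "norm a * (M * t) ^ k / fact k \<le> norm a * (M * T) ^ k / fact k"
      by (intro divide_right_mono mult_left_mono) auto
    with U_bound[OF t, of k] show "norm (U k t) \<le> norm a * ((M * T) ^ k / fact k)"
      by simp
  qed
  \<comment> \<open>Termwise differentiation loses an index: the derivative of the sum over
    \<open>k < Suc n\<close> is the right-hand side at the sum over \<open>k < n\<close>, since
    \<open>U 0\<close> is constant. Hence the derivatives converge uniformly to
    \<open>m (u t) (B t)\<close>.\<close>
  have "\<exists>g. \<forall>t\<in>{0..T}. (\<lambda>n. \<Sum>k<Suc n. U k t) \<longlonglongrightarrow> g t \<and>
      (g has_derivative (\<lambda>h. h *\<^sub>R m (u t) (B t))) (at t within {0..T})"
  proof (rule has_derivative_sequence)
    fix n t assume t: "t \<in> {0..T}"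
    have "((\<lambda>t. \<Sum>k<Suc n. U k t) has_vector_derivative (\<Sum>k<n. m (U k t) (B t))) (at t within {0..T})"
    proof (induction n)
      case 0
      then show ?case by (simp add: U_0)
    next
      case (Suc n)
      then show ?case using has_vector_derivative_add[OF Suc U_deriv[OF t, of n]] by simp
    qed
    then show "((\<lambda>t. \<Sum>k<Suc n. U k t) has_derivative (\<lambda>h. h *\<^sub>R m (\<Sum>k<n. U k t) (B t))) (at t within {0..T})"
      by (simp add: has_vector_derivative_def sum_left)
  next
    fix e :: real assume e: "e > 0"
    \<comment> \<open>Only \<open>M \<ge> 0\<close> was recorded, so \<open>M + 1\<close> serves as
      a positive denominator.\<close>
    have "\<forall>\<^sub>F n in sequentially. \<forall>t\<in>{0..T}. dist (\<Sum>k<n. U k t) (u t) < e / (M + 1)"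
      using lim e M by (intro uniform_limitD) auto
    then show "\<forall>\<^sub>F n in sequentially. \<forall>t\<in>{0..T}. \<forall>h.
        norm (h *\<^sub>R m (\<Sum>k<n. U k t) (B t) - h *\<^sub>R m (u t) (B t)) \<le> e * norm h"
    proof (rule eventually_mono, safe)
      fix n t h assume *: "\<forall>t\<in>{0..T}. dist (\<Sum>k<n. U k t) (u t) < e / (M + 1)" and t: "t \<in> {0..T}"
      have "norm (m ((\<Sum>k<n. U k t) - u t) (B t)) \<le> M * norm ((\<Sum>k<n. U k t) - u t)"
        by (rule mB[OF t])
      also have "\<dots> \<le> (M + 1) * (e / (M + 1))"
        using * t M by (intro mult_mono) (auto simp: dist_norm intro: less_imp_le)
      also have "\<dots> = e" using M by simp
      finally have "\<bar>h\<bar> * norm (m ((\<Sum>k<n. U k t) - u t) (B t)) \<le> \<bar>h\<bar> * e"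
        by (rule mult_left_mono) simp
      then show "norm (h *\<^sub>R m (\<Sum>k<n. U k t) (B t) - h *\<^sub>R m (u t) (B t)) \<le> e * norm h"
        by (simp add: diff_left mult.commute flip: scaleR_diff_right)
    qed
  next
    show "(0::real) \<in> {0..T}" using T by simp
    then show "(\<lambda>n. \<Sum>k<Suc n. U k 0) \<longlonglongrightarrow> u 0"
      using tendsto_uniform_limitI[OF lim] by (rule_tac LIMSEQ_Suc)
  qed auto
  then obtain g where g: "\<And>t. t \<in> {0..T} \<Longrightarrow> (\<lambda>n. \<Sum>k<Suc n. U k t) \<longlonglongrightarrow> g t"
      "\<And>t. t \<in> {0..T} \<Longrightarrow> (g has_derivative (\<lambda>h. h *\<^sub>R m (u t) (B t))) (at t within {0..T})"
    by blast
  have gu: "g t = u t" if "t \<in> {0..T}" for t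
    using LIMSEQ_unique[OF g(1)[OF that] LIMSEQ_Suc[OF tendsto_uniform_limitI[OF lim that]]] .
  have "U k 0 = 0" if "k > 0" for k
    using that by (cases k) (auto simp: U_Suc)
  then have "u 0 = a"
    unfolding u_def using suminf_finite[of "{0}" "\<lambda>k. U k 0"] by (simp add: U_0)
  moreover have "(u has_vector_derivative m (u t) (B t)) (at t within {0..T})" if "t \<in> {0..T}" for t
    unfolding has_vector_derivative_def
    by (rule has_derivative_transform[OF that _ g(2)[OF that]]) (simp add: gu)
  ultimately show ?thesis by blast
qed

lemma bounded_partials_imp_continuous_on:
  fixes f :: "real \<times> real \<Rightarrow> 'a::real_normed_vector"
  assumes fx: "\<And>x t. x \<in> {0..L} \<Longrightarrow> t \<in> {0..T} \<Longrightarrow>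
      ((\<lambda>\<xi>. f (\<xi>, t)) has_vector_derivative fx (x, t)) (at x within {0..L})"
    and ft: "\<And>x t. x \<in> {0..L} \<Longrightarrow> t \<in> {0..T} \<Longrightarrow>
      ((\<lambda>\<tau>. f (x, \<tau>)) has_vector_derivative ft (x, t)) (at t within {0..T})"
    and b: "\<And>w. w \<in> {0..L} \<times> {0..T} \<Longrightarrow> norm (fx w) \<le> K" "\<And>w. w \<in> {0..L} \<times> {0..T} \<Longrightarrow> norm (ft w) \<le> K"
  shows "continuous_on ({0..L} \<times> {0..T}) f"
proof (cases "{0..L} \<times> {0..T} = {}")
  case True
  then show ?thesis by (metis continuous_on_empty)
next
  case False
  then have K: "K \<ge> 0" using b(1) norm_ge_zero order_trans by (metis equals0I)
  have on: "onorm (\<lambda>h. h *\<^sub>R z) \<le> K" if "norm z \<le> K" for z :: 'a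
    using that by (intro onorm_bound K) (simp add: mult.commute[of K] mult_left_mono)
  have "(2 * K)-lipschitz_on ({0..L} \<times> {0..T}) f"
  proof (rule lipschitz_onI)
    fix w w' :: "real \<times> real" assume w: "w \<in> {0..L} \<times> {0..T}" "w' \<in> {0..L} \<times> {0..T}"
    obtain x t y s where eq: "w = (x, t)" "w' = (y, s)" by (cases w, cases w')
    have xt: "x \<in> {0..L}" "t \<in> {0..T}" "y \<in> {0..L}" "s \<in> {0..T}" using w eq by auto
    have 1: "norm (f (x, t) - f (y, t)) \<le> K * norm (x - y)"
      using fx b(1) xt unfolding has_vector_derivative_def
      by (intro differentiable_bound[of "{0..L}" "\<lambda>\<xi>. f (\<xi>, t)" "\<lambda>\<xi> h. h *\<^sub>R fx (\<xi>, t)"] on) auto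
    have 2: "norm (f (y, t) - f (y, s)) \<le> K * norm (t - s)"
      using ft b(2) xt unfolding has_vector_derivative_def
      by (intro differentiable_bound[of "{0..T}" "\<lambda>\<tau>. f (y, \<tau>)" "\<lambda>\<tau> h. h *\<^sub>R ft (y, \<tau>)"] on) auto
    have "dist (f w) (f w') \<le> norm (f (x, t) - f (y, t)) + norm (f (y, t) - f (y, s))"
      by (simp add: eq dist_norm) (metis dist_norm dist_triangle)
    also have "\<dots> \<le> K * norm (x - y) + K * norm (t - s)" using 1 2 by simp
    also have "\<dots> \<le> K * dist w w' + K * dist w w'"
      using dist_fst_le[of w w'] dist_snd_le[of w w'] K
      by (intro add_mono mult_left_mono) (auto simp: eq dist_norm)
    finally show "dist (f w) (f w') \<le> 2 * K * dist w w'" by simp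
  qed (use K in auto)
  then show ?thesis by (rule lipschitz_on_continuous_on)
qed


text \<open>One \<open>d\<close> serves all \<open>x\<close> and \<open>t\<close>, because
  \<open>fx\<close> is uniformly continuous on the compact rectangle. The uniformity in
  \<open>t\<close> lets the remainder enter Gronwall's inequality, which needs its bound along a
  whole column.\<close>

lemma vector_derivative_uniform_linearization:
  fixes f :: "real \<times> real \<Rightarrow> 'a::real_normed_vector"
  assumes fx: "\<And>x t. x \<in> {0..L} \<Longrightarrow> t \<in> {0..T} \<Longrightarrow>
      ((\<lambda>\<xi>. f (\<xi>, t)) has_vector_derivative fx (x, t)) (at x within {0..L})"
    and cont: "continuous_on ({0..L} \<times> {0..T}) fx" and e: "e > 0"
  obtains d where "d > 0"
    "\<And>x y t. x \<in> {0..L} \<Longrightarrow> y \<in> {0..L} \<Longrightarrow> t \<in> {0..T} \<Longrightarrow> \<bar>y - x\<bar> < d \<Longrightarrow>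
      norm (f (y, t) - f (x, t) - (y - x) *\<^sub>R fx (x, t)) \<le> e * \<bar>y - x\<bar>"
proof -
  have "uniformly_continuous_on ({0..L} \<times> {0..T}) fx"
    by (intro compact_uniformly_continuous cont compact_Times compact_Icc)
  then obtain d where d: "d > 0" "\<And>w w'. w \<in> {0..L} \<times> {0..T} \<Longrightarrow> w' \<in> {0..L} \<times> {0..T} \<Longrightarrow>
      dist w' w < d \<Longrightarrow> dist (fx w') (fx w) < e"
    using e unfolding uniformly_continuous_on_def by metis
  show thesis
  proof (rule that[OF d(1)])
    fix x y t assume xyt: "x \<in> {0..L}" "y \<in> {0..L}" "t \<in> {0..T}" and close: "\<bar>y - x\<bar> < d"
    have seg: "closed_segment x y \<subseteq> {0..L}"
      using xyt by (intro closed_segment_subset) auto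
    have "norm (f (y, t) - f (x, t) - (y - x) *\<^sub>R fx (x, t)) \<le> norm (y - x) * e"
    proof (rule vector_differentiable_bound_linearization[where S = "closed_segment x y" and f' = "\<lambda>\<xi>. fx (\<xi>, t)"])
      fix \<xi> assume \<xi>: "\<xi> \<in> closed_segment x y"
      then show "((\<lambda>\<xi>. f (\<xi>, t)) has_vector_derivative fx (\<xi>, t)) (at \<xi> within closed_segment x y)"
        using seg xyt by (intro has_vector_derivative_within_subset[OF fx seg]) auto
      have "\<bar>\<xi> - x\<bar> \<le> \<bar>y - x\<bar>"
        using \<xi> by (auto simp: closed_segment_eq_real_ivl split: if_splits)
      then have "dist (fx (\<xi>, t)) (fx (x, t)) < e"
        using \<xi> seg xyt close by (intro d(2)) (auto simp: dist_Pair_Pair dist_real_def)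
      then show "norm (fx (\<xi>, t) - fx (x, t)) \<le> e" by (simp add: dist_norm)
    qed auto
    then show "norm (f (y, t) - f (x, t) - (y - x) *\<^sub>R fx (x, t)) \<le> e * \<bar>y - x\<bar>"
      by (simp add: mult.commute)
  qed
qed

text \<open>
  The solution is defined row by row through the equation in \<open>t\<close>. Its \<open>x\<close>-derivative is found
  without differentiating in a parameter: by compatibility the remainder
  \<open>u (y, t) - u (x, t) - (y - x) *\<^sub>R m (u (x, t)) (\<alpha> (x, t))\<close> solves the same equation in \<open>t\<close>
  up to an error \<open>o(y - x)\<close>, so it is \<open>o(y - x)\<close> by Gronwall's inequality.
\<close>
lemma overdetermined_linear_system_exists:
  fixes m :: "'a::euclidean_space \<Rightarrow> 'b::real_normed_vector \<Rightarrow> 'a"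
  assumes m: "bounded_bilinear m" and L: "L > 0" and T: "T > 0"
    and \<alpha>: "continuous_on ({0..L} \<times> {0..T}) \<alpha>" and \<beta>: "continuous_on ({0..L} \<times> {0..T}) \<beta>"
    and \<alpha>t: "\<And>x t. x \<in> {0..L} \<Longrightarrow> t \<in> {0..T} \<Longrightarrow>
      ((\<lambda>\<tau>. \<alpha> (x, \<tau>)) has_vector_derivative \<alpha>t (x, t)) (at t within {0..T})"
    and \<beta>x: "\<And>x t. x \<in> {0..L} \<Longrightarrow> t \<in> {0..T} \<Longrightarrow>
      ((\<lambda>\<xi>. \<beta> (\<xi>, t)) has_vector_derivative \<beta>x (x, t)) (at x within {0..L})"
    and \<beta>x_cont: "continuous_on ({0..L} \<times> {0..T}) \<beta>x"
    and compat: "\<And>w z. w \<in> {0..L} \<times> {0..T} \<Longrightarrow>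
      m (m z (\<beta> w)) (\<alpha> w) + m z (\<alpha>t w) = m (m z (\<alpha> w)) (\<beta> w) + m z (\<beta>x w)"
    and u0: "\<And>x. x \<in> {0..L} \<Longrightarrow> (u0 has_vector_derivative m (u0 x) (\<alpha> (x, 0))) (at x within {0..L})"
  shows "\<exists>u. continuous_on ({0..L} \<times> {0..T}) u \<and> (\<forall>x\<in>{0..L}. u (x, 0) = u0 x) \<and>
    (\<forall>x\<in>{0..L}. \<forall>t\<in>{0..T}.
      ((\<lambda>\<xi>. u (\<xi>, t)) has_vector_derivative m (u (x, t)) (\<alpha> (x, t))) (at x within {0..L}) \<and>
      ((\<lambda>\<tau>. u (x, \<tau>)) has_vector_derivative m (u (x, t)) (\<beta> (x, t))) (at t within {0..T}))"
proof -
  let ?S = "{0..L} \<times> {0..T}"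
  interpret bounded_bilinear m by (rule m)
  obtain K where K: "K > 0" "\<And>a b. norm (m a b) \<le> norm a * norm b * K"
    using pos_bounded by blast
  have mK: "norm (m a b) \<le> p * q * K" if "norm a \<le> p" "norm b \<le> q" for a b p q
    using K(2)[of a b] that K(1)
    by (meson less_eq_real_def mult_mono mult_right_mono norm_ge_zero order_trans)
  have S: "compact ?S" by (intro compact_Times compact_Icc)
  obtain a where a: "a > 0" "\<And>w. w \<in> ?S \<Longrightarrow> norm (\<alpha> w) \<le> a"
    using continuous_on_compact_norm_bound[OF \<alpha> S] by blast
  obtain b where b: "b > 0" "\<And>w. w \<in> ?S \<Longrightarrow> norm (\<beta> w) \<le> b"
    using continuous_on_compact_norm_bound[OF \<beta> S] by blast
  have "continuous_on {0..L} u0"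
    using u0 by (meson continuous_on_eq_continuous_within has_vector_derivative_continuous)
  then obtain c where c: "c > 0" "\<And>x. x \<in> {0..L} \<Longrightarrow> norm (u0 x) \<le> c"
    using continuous_on_compact_norm_bound[OF _ compact_Icc] by blast
  have "\<exists>v. v 0 = u0 x \<and>
      (\<forall>t\<in>{0..T}. (v has_vector_derivative m (v t) (\<beta> (x, t))) (at t within {0..T}))"
    if "x \<in> {0..L}" for x
    using that by (intro linear_ode_exists[OF m] continuous_on_compose2[OF \<beta>])
      (auto intro!: continuous_intros)
  then obtain v where v: "\<And>x. x \<in> {0..L} \<Longrightarrow> v x 0 = u0 x"
      "\<And>x t. x \<in> {0..L} \<Longrightarrow> t \<in> {0..T} \<Longrightarrow>
        (v x has_vector_derivative m (v x t) (\<beta> (x, t))) (at t within {0..T})"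
    by metis
  \<comment> \<open>\<open>G\<close> is the factor in Gronwall's inequality when
    \<open>m z (\<beta> w)\<close> is bounded by \<open>b * K\<close> times the norm of
    \<open>z\<close>; it is the same for all columns.\<close>
  define G where "G = (1 + T) * exp ((2 * (b * K) + 1) * T)"
  have G: "G > 0" using T by (simp add: G_def)
  have gron: "norm (E t) \<le> G * (norm (E 0) + r)"
    if "\<And>s. s \<in> {0..T} \<Longrightarrow> (E has_vector_derivative m (E s) (\<beta> (x, s)) + R s) (at s within {0..T})"
      "\<And>s. s \<in> {0..T} \<Longrightarrow> norm (R s) \<le> r" "x \<in> {0..L}" "t \<in> {0..T}" for E R r x t
    unfolding G_def
  proof (rule gronwall[OF that(1) _ _ _ that(4)])
    show "0 \<le> r" using that(2)[OF that(4)] norm_ge_zero order_trans by blast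
    show "0 \<le> b * K" using b K by simp
    fix s assume s: "s \<in> {0..T}"
    have "norm (m (E s) (\<beta> (x, s))) \<le> norm (E s) * b * K"
      using s that(3) by (intro mK b) auto
    then show "norm (m (E s) (\<beta> (x, s)) + R s) \<le> b * K * norm (E s) + r"
      using that(2)[OF s] by (intro norm_triangle_mono) (auto simp: mult.commute mult.left_commute)
  qed
  have v_bound: "norm (v x t) \<le> G * c" if "x \<in> {0..L}" "t \<in> {0..T}" for x t
  proof -
    have "norm (v x t) \<le> G * (norm (v x 0) + 0)"
      by (rule gron[where R = "\<lambda>_. 0", OF _ _ that]) (use v that in auto)
    also have "\<dots> \<le> G * c" using c(2) that G by (simp add: v)
    finally show ?thesis .
  qed
  have vx: "((\<lambda>\<xi>. v \<xi> t) has_vector_derivative m (v x t) (\<alpha> (x, t))) (at x within {0..L})"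
    if xt: "x \<in> {0..L}" "t \<in> {0..T}" for x t
    unfolding has_vector_derivative_def has_derivative_within_alt
  proof (intro conjI allI impI)
    show "bounded_linear (\<lambda>h. h *\<^sub>R m (v x t) (\<alpha> (x, t)))" by (rule bounded_linear_scaleR_left)
    fix e :: real assume e: "e > 0"
    \<comment> \<open>\<open>Z\<close> bounds \<open>m (v x s) (\<alpha> (x, s))\<close>. The
      denominator of \<open>\<epsilon>\<close> anticipates the three contributions to the final
      estimate: the initial remainder and the two summands of \<open>R\<close> below.\<close>
    define Z where "Z = G * c * a * K"
    define \<epsilon> where "\<epsilon> = e / (G * (1 + G * c * K + Z * K))"
    have Z: "Z > 0" using G a c K by (simp add: Z_def)
    then have pos: "1 + G * c * K + Z * K > 0" using G a c K by (simp add: add_pos_pos)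
    then have \<epsilon>: "\<epsilon> > 0" using e G by (simp add: \<epsilon>_def)
    obtain d1 where d1: "d1 > 0" "\<And>x y t. x \<in> {0..L} \<Longrightarrow> y \<in> {0..L} \<Longrightarrow> t \<in> {0..T} \<Longrightarrow>
        \<bar>y - x\<bar> < d1 \<Longrightarrow> norm (\<beta> (y, t) - \<beta> (x, t) - (y - x) *\<^sub>R \<beta>x (x, t)) \<le> \<epsilon> * \<bar>y - x\<bar>"
      using vector_derivative_uniform_linearization[OF \<beta>x \<beta>x_cont \<epsilon>] by blast
    have "uniformly_continuous_on ?S \<beta>"
      by (intro compact_uniformly_continuous \<beta> S)
    then obtain d2 where d2: "d2 > 0" "\<And>w w'. w \<in> ?S \<Longrightarrow> w' \<in> ?S \<Longrightarrow>
        dist w' w < d2 \<Longrightarrow> dist (\<beta> w') (\<beta> w) < \<epsilon>"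
      using \<epsilon> unfolding uniformly_continuous_on_def by metis
    obtain d3 where d3: "d3 > 0" "\<And>y. y \<in> {0..L} \<Longrightarrow> \<bar>y - x\<bar> < d3 \<Longrightarrow>
        norm (u0 y - u0 x - (y - x) *\<^sub>R m (u0 x) (\<alpha> (x, 0))) \<le> \<epsilon> * \<bar>y - x\<bar>"
      using u0[OF xt(1)] \<epsilon> unfolding has_vector_derivative_def has_derivative_within_alt real_norm_def
      by blast
    show "\<exists>d>0. \<forall>y\<in>{0..L}. norm (y - x) < d \<longrightarrow>
        norm (v y t - v x t - (y - x) *\<^sub>R m (v x t) (\<alpha> (x, t))) \<le> e * norm (y - x)"
    proof (intro exI[of _ "min d1 (min d2 d3)"] conjI ballI impI)
      fix y assume y: "y \<in> {0..L}" and close: "norm (y - x) < min d1 (min d2 d3)"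
      define h where "h = y - x"
      define E where "E = (\<lambda>t. v y t - v x t - h *\<^sub>R m (v x t) (\<alpha> (x, t)))"
      \<comment> \<open>\<open>R\<close> is what remains of the derivative of \<open>E\<close> after
        \<open>m (E t) (\<beta> (y, t))\<close> is subtracted. Its first summand contains the
        first-order remainder of \<open>\<beta>\<close> in \<open>x\<close>; the second carries the
        factor \<open>h\<close> already, so continuity of \<open>\<beta>\<close> is enough
        there.\<close>
      define R where "R = (\<lambda>t. m (v x t) (\<beta> (y, t) - \<beta> (x, t) - h *\<^sub>R \<beta>x (x, t))
          + h *\<^sub>R m (m (v x t) (\<alpha> (x, t))) (\<beta> (y, t) - \<beta> (x, t)))"
      define r where "r = G * c * (\<epsilon> * \<bar>h\<bar>) * K + \<bar>h\<bar> * (Z * \<epsilon> * K)"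
      have "norm (E t) \<le> G * (norm (E 0) + r)"
      proof (rule gron[OF _ _ y xt(2)])
        fix s assume s: "s \<in> {0..T}"
        have "(E has_vector_derivative m (v y s) (\<beta> (y, s)) - m (v x s) (\<beta> (x, s))
            - h *\<^sub>R (m (v x s) (\<alpha>t (x, s)) + m (m (v x s) (\<beta> (x, s))) (\<alpha> (x, s)))) (at s within {0..T})"
          unfolding E_def using xt(1) y s
          by (intro has_vector_derivative_diff v has_vector_derivative \<alpha>t
              bounded_linear.has_vector_derivative[OF bounded_linear_scaleR_right]) auto
        \<comment> \<open>Here compatibility enters: it exchanges the time derivative of
          \<open>\<alpha>\<close> for the \<open>x\<close>-derivative of \<open>\<beta>\<close>, so
          that apart from \<open>m (E s) (\<beta> (y, s))\<close> only increments and remainders of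
          \<open>\<beta>\<close> survive.\<close>
        moreover have "m (v x s) (\<alpha>t (x, s)) + m (m (v x s) (\<beta> (x, s))) (\<alpha> (x, s))
            = m (m (v x s) (\<alpha> (x, s))) (\<beta> (x, s)) + m (v x s) (\<beta>x (x, s))"
          using compat[of "(x, s)" "v x s"] xt s by (simp add: add.commute)
        ultimately show "(E has_vector_derivative m (E s) (\<beta> (y, s)) + R s) (at s within {0..T})"
          by (simp add: E_def R_def diff_left diff_right add_left add_right scaleR_left scaleR_right algebra_simps)
        have "norm (m (v x s) (\<alpha> (x, s))) \<le> Z"
          unfolding Z_def using xt s by (intro mK v_bound a) auto
        moreover have "norm (\<beta> (y, s) - \<beta> (x, s)) \<le> \<epsilon>"
          using d2(2)[of "(x, s)" "(y, s)"] xt y s close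
          by (auto simp: dist_norm norm_Pair intro: less_imp_le)
        moreover have "norm (\<beta> (y, s) - \<beta> (x, s) - h *\<^sub>R \<beta>x (x, s)) \<le> \<epsilon> * \<bar>h\<bar>"
          using d1(2)[OF xt(1) y s] close by (simp add: h_def)
        ultimately have "norm (m (v x s) (\<beta> (y, s) - \<beta> (x, s) - h *\<^sub>R \<beta>x (x, s))) \<le> G * c * (\<epsilon> * \<bar>h\<bar>) * K"
            "norm (m (m (v x s) (\<alpha> (x, s))) (\<beta> (y, s) - \<beta> (x, s))) \<le> Z * \<epsilon> * K"
          using xt s by (auto intro!: mK v_bound)
        then show "norm (R s) \<le> r"
          unfolding R_def r_def by (intro norm_triangle_mono) (simp_all add: mult_left_mono)
      qed
      also have "\<dots> \<le> G * (\<epsilon> * \<bar>h\<bar> + r)"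
        using d3(2)[OF y] close xt y T G by (simp add: E_def v h_def)
      also have "\<dots> = (\<epsilon> * (G * (1 + G * c * K + Z * K))) * \<bar>h\<bar>"
        by (simp add: r_def algebra_simps)
      also have "\<epsilon> * (G * (1 + G * c * K + Z * K)) = e"
        using G pos by (simp add: \<epsilon>_def)
      finally show "norm (v y t - v x t - (y - x) *\<^sub>R m (v x t) (\<alpha> (x, t))) \<le> e * norm (y - x)"
        by (simp add: E_def h_def)
    qed (use d1 d2 d3 in auto)
  qed
  define u where "u = (\<lambda>w. v (fst w) (snd w))"
  \<comment> \<open>A single constant has to bound both partial derivatives, hence the sum.\<close>
  define C where "C = G * c * a * K + G * c * b * K"
  have C: "norm (m (u w) (\<alpha> w)) \<le> C" "norm (m (u w) (\<beta> w)) \<le> C" if "w \<in> ?S" for w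
  proof -
    have "norm (m (u w) (\<alpha> w)) \<le> G * c * a * K" "norm (m (u w) (\<beta> w)) \<le> G * c * b * K"
      using that by (auto simp: u_def intro!: mK v_bound a b)
    moreover have "G * c * a * K \<ge> 0" "G * c * b * K \<ge> 0" using G a b c K by simp_all
    ultimately show "norm (m (u w) (\<alpha> w)) \<le> C" "norm (m (u w) (\<beta> w)) \<le> C"
      unfolding C_def by linarith+
  qed
  have "continuous_on ?S u"
    by (rule bounded_partials_imp_continuous_on[where K = C and fx = "\<lambda>w. m (u w) (\<alpha> w)" and ft = "\<lambda>w. m (u w) (\<beta> w)"])
       (use vx v C in \<open>auto simp: u_def\<close>)
  then show ?thesis
    using v vx by (intro exI[of _ u]) (simp add: u_def)
qed

section \<open>Rigid body kinematics\<close>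

lemma C_diff_on_vector_derivative:
  fixes f :: "real \<Rightarrow> 'b::real_normed_vector"
  assumes L: "L > 0" and f: "C_diff_on (Suc k) {0..L} f"
  shows "C_diff_on k {0..L} (\<lambda>x. vector_derivative f (at x within {0..L}))"
    and "\<And>x. x \<in> {0..L} \<Longrightarrow>
      (f has_vector_derivative vector_derivative f (at x within {0..L})) (at x within {0..L})"
proof -
  obtain f' where f': "\<And>x. x \<in> {0..L} \<Longrightarrow> (f has_derivative f' x) (at x within {0..L})"
      "\<And>h. C_diff_on k {0..L} (\<lambda>x. f' x h)"
    using f unfolding C_diff_on.simps by blast
  have der: "(f has_vector_derivative f' x 1) (at x within {0..L})" if "x \<in> {0..L}" for x
  proof -
    have "f' x h = h *\<^sub>R f' x 1" for h
      using linear_scale[OF bounded_linear.linear[OF has_derivative_bounded_linear[OF f'(1)[OF that]]], of h 1]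
      by (simp only: real_scaleR_def mult_1_right)
    with f'(1)[OF that] show ?thesis
      unfolding has_vector_derivative_def by (elim has_derivative_eq_rhs) (rule ext)
  qed
  have eq: "vector_derivative f (at x within {0..L}) = f' x 1" if "x \<in> {0..L}" for x
    using vector_derivative_within_cbox[of 0 L x f] der[OF that] that L by auto
  show "C_diff_on k {0..L} (\<lambda>x. vector_derivative f (at x within {0..L}))"
    by (rule C_diff_on_cong[THEN iffD2, OF eq f'(2)])
  show "(f has_vector_derivative vector_derivative f (at x within {0..L})) (at x within {0..L})"
    if "x \<in> {0..L}" for x
    by (subst eq) (use der that in auto)
qed

text \<open>The open rectangle is dense in the closed one. The compatibility equation is given in
  the open rectangle, while the system is integrated on the closed one.\<close>

lemma continuous_eq_on_closed_rectangle:
  fixes f g :: "real \<times> real \<Rightarrow> 'b::real_normed_vector"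
  assumes "L > 0" "T > 0" and "continuous_on ({0..L} \<times> {0..T}) f" "continuous_on ({0..L} \<times> {0..T}) g"
    and eq: "\<And>x t. x \<in> {0<..<L} \<Longrightarrow> t \<in> {0<..<T} \<Longrightarrow> f (x, t) = g (x, t)"
    and w: "w \<in> {0..L} \<times> {0..T}"
  shows "f w = g w"
proof -
  have cl: "closure ({0<..<L} \<times> {0<..<T}) = {0..L} \<times> {0..T}"
    using assms(1,2) by (simp add: closure_Times)
  have "f w - g w = 0"
  proof (rule continuous_constant_on_closure[where f = "\<lambda>w. f w - g w" and S = "{0<..<L} \<times> {0<..<T}"])
    show "continuous_on (closure ({0<..<L} \<times> {0<..<T})) (\<lambda>w. f w - g w)"
      unfolding cl by (intro continuous_on_diff assms)
    show "f w - g w = 0" if "w \<in> {0<..<L} \<times> {0<..<T}" for w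
      using eq[of "fst w" "snd w"] that by (simp add: mem_Times_iff)
  qed (use w cl in simp)
  then show ?thesis by simp
qed

lemma continuous_eq_on_closed_interval:
  fixes f g :: "real \<Rightarrow> 'b::real_normed_vector"
  assumes "L > 0" and "continuous_on {0..L} f" "continuous_on {0..L} g"
    and eq: "\<And>x. x \<in> {0<..<L} \<Longrightarrow> f x = g x" and x: "x \<in> {0..L}"
  shows "f x = g x"
proof -
  have cl: "closure {0<..<L} = {0..L}" using assms(1) by simp
  have "f x - g x = 0"
  proof (rule continuous_constant_on_closure[where f = "\<lambda>x. f x - g x" and S = "{0<..<L}"])
    show "continuous_on (closure {0<..<L}) (\<lambda>x. f x - g x)"
      unfolding cl by (intro continuous_on_diff assms)
    show "f x - g x = 0" if "x \<in> {0<..<L}" for x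
      using eq[OF that] by simp
  qed (use x cl in simp)
  then show ?thesis by simp
qed

text \<open>A function that is C^1 up to the ends has a continuous one-sided derivative, which
  agrees with the continuous \<open>g\<close> at the ends as well. In this way the equations for the
  initial and the Dirichlet data reach the endpoints of their intervals.\<close>

lemma C1_has_vector_derivative_closed_interval:
  fixes f :: "real \<Rightarrow> 'b::real_normed_vector"
  assumes L: "L > 0" and f: "C_diff_on (Suc k) {0..L} f" and g: "continuous_on {0..L} g"
    and der: "\<And>x. x \<in> {0<..<L} \<Longrightarrow> (f has_vector_derivative g x) (at x)" and x: "x \<in> {0..L}"
  shows "(f has_vector_derivative g x) (at x within {0..L})"
proof -
  note D = C_diff_on_vector_derivative[OF L f]
  have "vector_derivative f (at x within {0..L}) = g x"
  proof (rule continuous_eq_on_closed_interval[OF L C_diff_on_imp_continuous_on[OF D(1)] g _ x])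
    fix x assume "x \<in> {0<..<L}"
    then show "vector_derivative f (at x within {0..L}) = g x"
      using der by (simp add: at_within_Icc_at vector_derivative_at)
  qed
  then show ?thesis using D(2)[OF x] by simp
qed

section \<open>Blocks and matrix products as linear and bilinear maps\<close>

lemma upper_stack [simp]: "upper (stack a b) = a"
  and lower_stack [simp]: "lower (stack a b) = b"
  by (simp_all add: upper_def lower_def stack_def vec_eq_iff)

lemma stack_upper_lower: "stack (upper y) (lower y) = y"
  by (simp add: upper_def lower_def stack_def vec_eq_iff split: sum.split)

lemma stack_eq_iff: "stack a b = y \<longleftrightarrow> a = upper y \<and> b = lower y"
  by (metis lower_stack upper_stack stack_upper_lower)

lemma bounded_linear_upper: "bounded_linear (upper :: real ^ ('m::finite + 'n::finite) \<Rightarrow> real ^ 'm)"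
  unfolding linear_conv_bounded_linear[symmetric]
  by (rule linearI) (simp_all add: upper_def vec_eq_iff)

lemma bounded_linear_lower: "bounded_linear (lower :: real ^ ('m::finite + 'n::finite) \<Rightarrow> real ^ 'n)"
  unfolding linear_conv_bounded_linear[symmetric]
  by (rule linearI) (simp_all add: lower_def vec_eq_iff)

lemma bounded_linear_stack:
  "bounded_linear (\<lambda>p :: (real ^ 'm::finite) \<times> (real ^ 'n::finite). stack (fst p) (snd p))"
  unfolding linear_conv_bounded_linear[symmetric]
  by (rule linearI) (simp_all add: stack_def vec_eq_iff split: sum.split)

lemmas upper_add = linear_add[OF bounded_linear.linear[OF bounded_linear_upper]]
  and lower_add = linear_add[OF bounded_linear.linear[OF bounded_linear_lower]]
  and upper_diff = linear_diff[OF bounded_linear.linear[OF bounded_linear_upper]]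
  and lower_diff = linear_diff[OF bounded_linear.linear[OF bounded_linear_lower]]
  and upper_scaleR = linear_scale[OF bounded_linear.linear[OF bounded_linear_upper]]
  and lower_scaleR = linear_scale[OF bounded_linear.linear[OF bounded_linear_lower]]

lemma C_diff_on_stack:
  fixes f :: "'a::real_normed_vector \<Rightarrow> real ^ 'm::finite" and g :: "'a \<Rightarrow> real ^ 'n::finite"
  assumes "C_diff_on k S f" "C_diff_on k S g"
  shows "C_diff_on k S (\<lambda>x. stack (f x) (g x))"
  using C_diff_on_linear[OF bounded_linear_stack C_diff_on_Pair[OF assms]] by simp

lemma block_matrix_mult:
  fixes A :: "real ^ 'm ^ 'm"
  shows "block_matrix A B C D *v y = stack (A *v upper y + B *v lower y) (C *v upper y + D *v lower y)"
  by (simp add: block_matrix_def stack_def upper_def lower_def matrix_vector_mult_def vec_eq_iff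
      UNIV_Plus_UNIV[symmetric] sum.Plus del: UNIV_Plus_UNIV split: sum.split)

lemma bounded_bilinear_matrix_vector_mult:
  "bounded_bilinear ((*v) :: real ^ 'n ^ 'm \<Rightarrow> real ^ 'n \<Rightarrow> real ^ 'm)"
  unfolding bilinear_conv_bounded_bilinear[symmetric] bilinear_def
  by (auto intro!: linearI simp: matrix_vector_mult_def vec_eq_iff sum.distrib algebra_simps sum_distrib_left)

lemma bounded_bilinear_matrix_matrix_mult:
  "bounded_bilinear ((**) :: real ^ 'n ^ 'm \<Rightarrow> real ^ 'k ^ 'n \<Rightarrow> real ^ 'k ^ 'm)"
  unfolding bilinear_conv_bounded_bilinear[symmetric] bilinear_def
  by (auto intro!: linearI simp: matrix_matrix_mult_def vec_eq_iff sum.distrib algebra_simps sum_distrib_left)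

lemma bounded_linear_transpose: "bounded_linear (transpose :: real ^ 'n ^ 'm \<Rightarrow> real ^ 'm ^ 'n)"
  unfolding linear_conv_bounded_linear[symmetric]
  by (rule linearI) (simp_all add: transpose_def vec_eq_iff)

section \<open>The hat map and the tangent spaces of SO(3)\<close>

lemma hat_nth:
  "hat u = vector [vector [0, - u $ 3, u $ 2], vector [u $ 3, 0, - u $ 1], vector [- u $ 2, u $ 1, 0]]"
  by (simp add: hat_def matrix_def cross3_def vec_eq_iff forall_3 axis_def)

lemma bounded_linear_hat: "bounded_linear hat"
  unfolding linear_conv_bounded_linear[symmetric]
  by (rule linearI) (simp_all add: hat_nth vec_eq_iff forall_3)

lemmas hat_add = linear_add[OF bounded_linear.linear[OF bounded_linear_hat]]
  and hat_scaleR = linear_scale[OF bounded_linear.linear[OF bounded_linear_hat]]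

lemma transpose_hat: "transpose (hat u) = - hat u"
  by (simp add: hat_nth transpose_def vec_eq_iff forall_3)

lemma hat_cross3: "hat (cross3 a b) = hat a ** hat b - hat b ** hat a"
  by (simp add: hat_nth cross3_def matrix_matrix_mult_def vec_eq_iff forall_3 sum_3 algebra_simps)

text \<open>A total linear inverse of \<open>hat\<close>. \<open>axial\<close> is a definite
  description with no known value off the skew matrices, so its regularity is obtained by replacing
  it with \<open>vee\<close> wherever the argument is skew.\<close>

definition vee :: "R33 \<Rightarrow> R3" where
  "vee A = vector [A $ 3 $ 2, A $ 1 $ 3, A $ 2 $ 1]"

lemma bounded_linear_vee: "bounded_linear vee"
  unfolding linear_conv_bounded_linear[symmetric]
  by (rule linearI) (simp_all add: vee_def vec_eq_iff forall_3)

lemma hat_vee: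
  assumes "transpose A = - A"
  shows "hat (vee A) = A"
proof -
  have anti: "A $ i $ j = - A $ j $ i" for i j
    using arg_cong[OF assms, of "\<lambda>M. M $ j $ i"] by (simp add: transpose_def)
  have "A $ i $ i = 0" for i using anti[of i i] by simp
  with anti[of 1 2] anti[of 1 3] anti[of 2 3]
  show ?thesis by (simp add: hat_nth vee_def vec_eq_iff forall_3)
qed

lemma axial_eq_vee: "transpose A = - A \<Longrightarrow> axial A = vee A"
  using axial_hat[of "vee A"] by (simp add: hat_vee)

lemma rotation_matrixD:
  assumes "rotation_matrix Q"
  shows "transpose Q ** Q = mat 1" "Q ** transpose Q = mat 1"
  using assms by (simp_all add: rotation_matrix_def orthogonal_matrix_def)

text \<open>Differentiating \<open>transpose R ** R = mat 1\<close> gives the skewness. It makes the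
  occurrences of \<open>axial\<close> in the transformation meaningful.\<close>

lemma SO3_derivative_skew:
  assumes L: "L > 0" and x: "x \<in> {0..L}" and R: "\<And>x. x \<in> {0..L} \<Longrightarrow> R x \<in> SO3"
    and D: "(R has_vector_derivative D) (at x within {0..L})"
  shows "transpose (transpose (R x) ** D) = - (transpose (R x) ** D)"
proof -
  have D1: "((\<lambda>x. transpose (R x) ** R x) has_vector_derivative transpose (R x) ** D + transpose D ** R x)
      (at x within {0..L})"
    by (intro bounded_bilinear.has_vector_derivative[OF bounded_bilinear_matrix_matrix_mult] D
        bounded_linear.has_vector_derivative[OF bounded_linear_transpose])
  have D2: "((\<lambda>x. transpose (R x) ** R x) has_vector_derivative 0) (at x within {0..L})"
    by (rule has_vector_derivative_transform[OF x _ has_vector_derivative_const[of "mat 1"]])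
       (use R rotation_matrixD in auto)
  have "transpose (R x) ** D + transpose D ** R x = 0"
    using vector_derivative_within_closed_interval[OF L x D1]
      vector_derivative_within_closed_interval[OF L x D2] by simp
  from minus_unique[OF this] show ?thesis
    by (simp add: matrix_transpose_mul)
qed

text \<open>
  \<open>se3 (p, R) (a, b) = (R a, R hat b)\<close> is the derivative of a curve of frames \<open>(p, R)\<close>
  with body velocity \<open>(a, b)\<close>, and \<open>body\<close> recovers the body velocity.
\<close>
definition se3 :: "R3 \<times> R33 \<Rightarrow> R6 \<Rightarrow> R3 \<times> R33" where
  "se3 u b = (snd u *v upper b, snd u ** hat (lower b))"

definition body :: "R3 \<times> R33 \<Rightarrow> R3 \<times> R33 \<Rightarrow> R6" where
  "body u D = stack (transpose (snd u) *v fst D) (axial (transpose (snd u) ** snd D))"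

text \<open>The Lie bracket of the Euclidean motion algebra se(3), translational block above
  rotational block: it corresponds to the commutator \<open>A ** B - B ** A\<close> of the 4 by 4
  matrices that represent \<open>a\<close> and \<open>b\<close>.\<close>

definition bracket :: "R6 \<Rightarrow> R6 \<Rightarrow> R6" where
  "bracket a b = stack (cross3 (lower a) (upper b) - cross3 (lower b) (upper a)) (cross3 (lower a) (lower b))"

lemma bounded_bilinear_se3: "bounded_bilinear se3"
proof -
  interpret v: bounded_bilinear "(*v) :: R33 \<Rightarrow> R3 \<Rightarrow> R3" by (rule bounded_bilinear_matrix_vector_mult)
  interpret m: bounded_bilinear "(**) :: R33 \<Rightarrow> R33 \<Rightarrow> R33" by (rule bounded_bilinear_matrix_matrix_mult)
  show ?thesis
    unfolding bilinear_conv_bounded_bilinear[symmetric] bilinear_def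
    by (auto intro!: linearI simp: se3_def upper_add lower_add upper_scaleR lower_scaleR hat_add hat_scaleR
        v.add_left v.add_right v.scaleR_left v.scaleR_right m.add_left m.add_right m.scaleR_left m.scaleR_right)
qed

text \<open>\<open>se3\<close> is right multiplication by 4 by 4 matrices, so acting with
  \<open>a\<close> and then with \<open>b\<close> multiplies in this order, and the difference is
  the action of the commutator. The identity holds for arbitrary matrices \<open>snd z\<close>,
  which is why the system can be solved before the solution is known to lie in SO(3).\<close>

lemma se3_commutator: "se3 (se3 z a) b - se3 (se3 z b) a = se3 z (bracket a b)"
proof -
  interpret v: bounded_bilinear "(*v) :: R33 \<Rightarrow> R3 \<Rightarrow> R3" by (rule bounded_bilinear_matrix_vector_mult)
  interpret m: bounded_bilinear "(**) :: R33 \<Rightarrow> R33 \<Rightarrow> R33" by (rule bounded_bilinear_matrix_matrix_mult)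
  show ?thesis
    by (simp add: se3_def bracket_def hat_cross3 v.diff_right m.diff_right hat_mult
        flip: matrix_vector_mul_assoc matrix_mul_assoc)
qed

lemma se3_inject:
  assumes "snd z \<in> SO3"
  shows "se3 z a = se3 z b \<longleftrightarrow> a = b"
proof
  assume eq: "se3 z a = se3 z b"
  have "upper a = upper b"
    using arg_cong[OF eq, of "\<lambda>u. transpose (snd z) *v fst u"] rotation_matrixD(1)[of "snd z"] assms
    by (simp add: se3_def matrix_vector_mul_assoc)
  moreover have "hat (lower a) = hat (lower b)"
    using arg_cong[OF eq, of "\<lambda>u. transpose (snd z) ** snd u"] rotation_matrixD(1)[of "snd z"] assms
    by (simp add: se3_def matrix_mul_assoc)
  then have "lower a = lower b" by (metis axial_hat)
  ultimately show "a = b" by (metis stack_upper_lower)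
qed simp

text \<open>The skewness condition says that \<open>snd D\<close> is tangent to SO(3) at
  \<open>snd u\<close>. For such \<open>D\<close>, \<open>hat\<close> undoes \<open>axial\<close>,
  so that \<open>body u\<close> inverts \<open>se3 u\<close>.\<close>

lemma body_eq_iff:
  assumes Q: "snd u \<in> SO3" and skew: "transpose (transpose (snd u) ** snd D) = - (transpose (snd u) ** snd D)"
  shows "body u D = b \<longleftrightarrow> D = se3 u b"
proof -
  have "se3 u (body u D) = D"
    using rotation_matrixD(2)[of "snd u"] Q
    by (simp add: se3_def body_def axial_eq_vee[OF skew] hat_vee[OF skew] matrix_vector_mul_assoc
        matrix_mul_assoc del: transpose_matrix_vector)
  then show ?thesis using se3_inject[OF Q, of "body u D" b] by auto
qed

lemma spd_invertible:
  assumes "spd_matrix A"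
  shows "invertible A"
proof -
  have "x = 0" if "A *v x = 0" for x
    using assms that unfolding spd_matrix_def by (metis inner_zero_right less_irrefl)
  then show ?thesis
    by (simp add: invertible_left_inverse matrix_left_invertible_ker)
qed

text \<open>By bilinearity the reference strain \<open>(e1, \<Upsilon>)\<close> produces the block
  matrix term linear in \<open>v\<close>, and \<open>s\<close> the quadratic one; antisymmetry of
  the cross product adjusts the signs.\<close>

lemma compat_eq_bracket:
  "s' - v' - block_matrix (hat \<Upsilon>) (hat e1) 0 (hat \<Upsilon>) *v v
      = - (block_matrix (hat (lower v)) (hat (upper v)) 0 (hat (lower v)) *v s)
   \<longleftrightarrow> s' - v' = bracket (s + stack e1 \<Upsilon>) v"
proof -
  have "bracket (s + stack e1 \<Upsilon>) v = block_matrix (hat \<Upsilon>) (hat e1) 0 (hat \<Upsilon>) *v v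
      - block_matrix (hat (lower v)) (hat (upper v)) 0 (hat (lower v)) *v s"
    unfolding block_matrix_mult
    by (simp add: bracket_def stack_eq_iff upper_diff lower_diff upper_add lower_add hat_mult
        cross_add_left cross_add_right cross_skew[of "lower v"] cross_skew[of "upper v"])
  then show ?thesis by (simp only:) (auto simp: algebra_simps)
qed

section \<open>A single beam\<close>

text \<open>The product \<open>R ** transpose R\<close> is constant, because the skew
  \<open>hat (\<omega> t)\<close> sits between the two factors; in the other order the terms would
  not cancel directly. The determinant is then 1 or -1 throughout and, being continuous, keeps its
  initial value.\<close>

lemma SO3_transport:
  fixes R :: "real \<Rightarrow> R33"
  assumes T: "T > 0" and init: "R 0 \<in> SO3"
    and R: "\<And>t. t \<in> {0..T} \<Longrightarrow> (R has_vector_derivative R t ** hat (\<omega> t)) (at t within {0..T})"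
    and t: "t \<in> {0..T}"
  shows "R t \<in> SO3"
proof -
  interpret m: bounded_bilinear "(**) :: R33 \<Rightarrow> R33 \<Rightarrow> R33" by (rule bounded_bilinear_matrix_matrix_mult)
  have const: "((\<lambda>t. R t ** transpose (R t)) has_vector_derivative 0) (at s within {0..T})"
    if s: "s \<in> {0..T}" for s
  proof -
    have "((\<lambda>t. R t ** transpose (R t)) has_vector_derivative
        R s ** transpose (R s ** hat (\<omega> s)) + (R s ** hat (\<omega> s)) ** transpose (R s)) (at s within {0..T})"
      by (intro m.has_vector_derivative R s bounded_linear.has_vector_derivative[OF bounded_linear_transpose])
    then show ?thesis
      by (simp add: matrix_transpose_mul transpose_hat m.minus_left m.minus_right matrix_mul_assoc)
  qed
  obtain c where c: "\<And>s. s \<in> {0..T} \<Longrightarrow> R s ** transpose (R s) = c"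
    using has_vector_derivative_zero_constant[OF convex_real_interval(5) const] by blast
  have one: "R s ** transpose (R s) = mat 1" if "s \<in> {0..T}" for s
    using c[OF that] c[of 0] rotation_matrixD(2)[of "R 0"] init T by simp
  have orth: "orthogonal_matrix (R s)" if "s \<in> {0..T}" for s
    using one[OF that] by (simp add: orthogonal_matrix matrix_left_right_inverse)
  have "continuous_on {0..T} R"
    using R by (meson continuous_on_eq_continuous_within has_vector_derivative_continuous)
  \<comment> \<open>Order 0 of the regularity calculus is continuity, so
    \<open>C_diff_on_det\<close> yields continuity of the determinant.\<close>
  then have "C_diff_on 0 {0..T} (\<lambda>s. R s $ i $ j)" for i j
    by (auto intro!: continuous_intros)
  then have cont: "continuous_on {0..T} (\<lambda>s. det (R s))"
    using C_diff_on_det[of 0 "{0..T}" R] by simp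
  have "det (R t) \<noteq> -1"
  proof
    assume "det (R t) = -1"
    then obtain s where "0 \<le> s" "s \<le> t" "det (R s) = 0"
      using IVT2'[of "\<lambda>s. det (R s)" t 0 0] continuous_on_subset[OF cont, of "{0..t}"] init t
      by (auto simp: rotation_matrix_def)
    then show False using det_orthogonal_matrix[OF orth[of s]] t by auto
  qed
  then show ?thesis
    using det_orthogonal_matrix[OF orth[OF t]] orth[OF t] by (auto simp: rotation_matrix_def)
qed

text \<open>The data of one edge, detached from the graph. Orders are written with
  \<open>Suc\<close> to match the recursion of \<open>C_diff_on\<close>.\<close>

locale beam =
  fixes L T :: real and C :: "real \<Rightarrow> R66" and Rc :: "real \<Rightarrow> R33"
  assumes L: "L > 0" and T: "T > 0"
    and C_C1: "C_diff_on (Suc 0) {0..L} C"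
    and C_spd: "\<And>x. x \<in> {0..L} \<Longrightarrow> spd_matrix (C x)"
    and Rc_C2: "C_diff_on (Suc (Suc 0)) {0..L} Rc"
    and Rc_SO3: "\<And>x. x \<in> {0..L} \<Longrightarrow> Rc x \<in> SO3"
begin

abbreviation S :: "(real \<times> real) set" where
  "S \<equiv> {0..L} \<times> {0..T}"

definition \<alpha> :: "(real \<times> real \<Rightarrow> R12) \<Rightarrow> real \<times> real \<Rightarrow> R6" where
  "\<alpha> y w = strain C y w + stack e1 (curv L Rc (fst w))"

definition \<beta> :: "(real \<times> real \<Rightarrow> R12) \<Rightarrow> real \<times> real \<Rightarrow> R6" where
  "\<beta> y w = upper (y w)"

definition frame_eqs :: "(real \<times> real \<Rightarrow> R3 \<times> R33) \<Rightarrow> (real \<times> real \<Rightarrow> R12) \<Rightarrow> bool" where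
  "frame_eqs q y \<longleftrightarrow> (\<forall>x\<in>{0..L}. \<forall>t\<in>{0..T}.
      ((\<lambda>\<xi>. q (\<xi>, t)) has_vector_derivative se3 (q (x, t)) (\<alpha> y (x, t))) (at x within {0..L}) \<and>
      ((\<lambda>\<tau>. q (x, \<tau>)) has_vector_derivative se3 (q (x, t)) (\<beta> y (x, t))) (at t within {0..T}))"

section \<open>Regularity of the coefficients\<close>

lemma C_inverse:
  assumes "x \<in> {0..L}"
  shows "C x *v (matrix_inv (C x) *v z) = z" "matrix_inv (C x) *v (C x *v z) = z"
  using invertible_matrix_inv[OF spd_invertible[OF C_spd[OF assms]]]
  by (simp_all add: matrix_vector_mul_assoc)

text \<open>The curvature costs one derivative of \<open>Rc\<close>; what is left, C^1, is the
  regularity that \<open>\<alpha>\<close> is to have.\<close>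

lemma curv_C1: "C_diff_on (Suc 0) {0..L} (curv L Rc)"
proof -
  note D = C_diff_on_vector_derivative[OF L Rc_C2]
  have "C_diff_on (Suc 0) {0..L}
      (\<lambda>x. vee (transpose (Rc x) ** vector_derivative Rc (at x within {0..L})))"
    by (intro C_diff_on_linear[OF bounded_linear_vee] C_diff_on_bilinear[OF bounded_bilinear_matrix_matrix_mult]
        C_diff_on_linear[OF bounded_linear_transpose] D(1) C_diff_on_SucD[OF Rc_C2])
  moreover have "curv L Rc x = vee (transpose (Rc x) ** vector_derivative Rc (at x within {0..L}))"
    if "x \<in> {0..L}" for x
    unfolding curv_def by (intro axial_eq_vee SO3_derivative_skew[OF L that Rc_SO3 D(2)[OF that]])
  ultimately show ?thesis
    by (rule C_diff_on_cong[THEN iffD2, rotated])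
qed

lemma \<beta>_C1: "C_diff_on (Suc 0) S y \<Longrightarrow> C_diff_on (Suc 0) S (\<beta> y)"
  unfolding \<beta>_def[abs_def] by (rule C_diff_on_linear[OF bounded_linear_upper])

lemma strain_C1: "C_diff_on (Suc 0) S y \<Longrightarrow> C_diff_on (Suc 0) S (strain C y)"
  unfolding strain_def[abs_def]
  by (intro C_diff_on_bilinear[OF bounded_bilinear_matrix_vector_mult] C_diff_on_compose_fst C_C1
      C_diff_on_linear[OF bounded_linear_lower])

lemma \<alpha>_C1: "C_diff_on (Suc 0) S y \<Longrightarrow> C_diff_on (Suc 0) S (\<alpha> y)"
  unfolding \<alpha>_def[abs_def]
  by (intro C_diff_on_add strain_C1 C_diff_on_stack C_diff_on_const C_diff_on_compose_fst[OF curv_C1])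

lemma dt_\<alpha>:
  assumes "C_diff_on (Suc 0) S y" "x \<in> {0..L}" "t \<in> {0..T}"
  shows "dt T (\<alpha> y) (x, t) = dt T (strain C y) (x, t)"
proof (rule dt_eqI[OF T assms(3)])
  have "((\<lambda>\<tau>. strain C y (x, \<tau>) + stack e1 (curv L Rc x)) has_vector_derivative
      dt T (strain C y) (x, t) + 0) (at t within {0..T})"
    by (intro has_vector_derivative_add has_vector_derivative_const
        C_diff_on_partials(4)[OF L T strain_C1] assms)
  then show "((\<lambda>\<tau>. \<alpha> y (x, \<tau>)) has_vector_derivative dt T (strain C y) (x, t)) (at t within {0..T})"
    by (simp add: \<alpha>_def)
qed

text \<open>The reference strain does not depend on time, so \<open>\<alpha>\<close> and the strain
  have the same time derivative. Both sides are continuous on the closed rectangle, to which the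
  equation therefore extends.\<close>

lemma compat_eq_iff:
  assumes y: "C_diff_on (Suc 0) S y"
  shows "compat_eq T L C Rc y \<longleftrightarrow>
    (\<forall>w\<in>S. dt T (\<alpha> y) w - dx L (\<beta> y) w = bracket (\<alpha> y w) (\<beta> y w))"
proof -
  have "compat_eq T L C Rc y \<longleftrightarrow> (\<forall>x\<in>{0<..<L}. \<forall>t\<in>{0<..<T}.
      dt T (\<alpha> y) (x, t) - dx L (\<beta> y) (x, t) = bracket (\<alpha> y (x, t)) (\<beta> y (x, t)))"
    unfolding compat_eq_def Let_def compat_eq_bracket
    by (intro ball_cong refl) (simp add: dt_\<alpha>[OF y] \<alpha>_def \<beta>_def[abs_def] comp_def)
  also have "\<dots> \<longleftrightarrow> (\<forall>w\<in>S. dt T (\<alpha> y) w - dx L (\<beta> y) w = bracket (\<alpha> y w) (\<beta> y w))"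
    (is "?I \<longleftrightarrow> ?J")
  proof
    note \<alpha> = \<alpha>_C1[OF y] and \<beta> = \<beta>_C1[OF y]
    have c: "continuous_on S (dt T (\<alpha> y))" "continuous_on S (dx L (\<beta> y))" "continuous_on S (\<alpha> y)" "continuous_on S (\<beta> y)"
      using C_diff_on_partials[OF L T \<alpha>] C_diff_on_partials[OF L T \<beta>]
      by (auto intro: C_diff_on_imp_continuous_on \<alpha> \<beta>)
    have "continuous_on S (\<lambda>w. bracket (\<alpha> y w) (\<beta> y w))"
    proof -
      have "C_diff_on 0 S (\<lambda>w. upper (\<alpha> y w))" "C_diff_on 0 S (\<lambda>w. lower (\<alpha> y w))"
          "C_diff_on 0 S (\<lambda>w. upper (\<beta> y w))" "C_diff_on 0 S (\<lambda>w. lower (\<beta> y w))"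
        using c by (auto intro: bounded_linear.continuous_on[OF bounded_linear_upper]
            bounded_linear.continuous_on[OF bounded_linear_lower])
      then have "C_diff_on 0 S (\<lambda>w. bracket (\<alpha> y w) (\<beta> y w))"
        unfolding bracket_def
        by (intro C_diff_on_stack C_diff_on_diff C_diff_on_bilinear[OF bilinear_cross[unfolded bilinear_conv_bounded_bilinear]])
      then show ?thesis by simp
    qed
    note c = c this
    assume ?I
    show ?J
    proof
      fix w assume w: "w \<in> S"
      show "dt T (\<alpha> y) w - dx L (\<beta> y) w = bracket (\<alpha> y w) (\<beta> y w)"
        using \<open>?I\<close>
        by (intro continuous_eq_on_closed_rectangle[OF L T continuous_on_diff[OF c(1,2)] c(5) _ w]) blast
    qed
  qed auto
  finally show ?thesis .
qed

lemma C_spaceD: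
  assumes "q \<in> C_space k S (UNIV \<times> SO3)"
  shows "C_diff_on k S q" "\<And>w. w \<in> S \<Longrightarrow> snd (q w) \<in> SO3"
  using assms by (auto simp: C_space_def mem_Times_iff PiE_iff)

section \<open>The transformation expressed through body velocities\<close>

lemma partials_skew:
  assumes q: "C_diff_on (Suc k) S q" "\<And>w. w \<in> S \<Longrightarrow> snd (q w) \<in> SO3" and w: "w \<in> S"
  shows "transpose (transpose (snd (q w)) ** snd (dt T q w)) = - (transpose (snd (q w)) ** snd (dt T q w))"
    and "transpose (transpose (snd (q w)) ** snd (dx L q w)) = - (transpose (snd (q w)) ** snd (dx L q w))"
proof -
  obtain x t where w: "w = (x, t)" and x: "x \<in> {0..L}" and t: "t \<in> {0..T}" using w by blast
  note D = C_diff_on_partials(3,4)[OF L T q(1) x t]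
  have "((\<lambda>\<tau>. snd (q (x, \<tau>))) has_vector_derivative snd (dt T q w)) (at t within {0..T})"
      "((\<lambda>\<xi>. snd (q (\<xi>, t))) has_vector_derivative snd (dx L q w)) (at x within {0..L})"
    unfolding w by (intro bounded_linear.has_vector_derivative[OF bounded_linear_snd] D)+
  then show "transpose (transpose (snd (q w)) ** snd (dt T q w)) = - (transpose (snd (q w)) ** snd (dt T q w))"
    "transpose (transpose (snd (q w)) ** snd (dx L q w)) = - (transpose (snd (q w)) ** snd (dx L q w))"
    using SO3_derivative_skew[OF T t, of "\<lambda>\<tau>. snd (q (x, \<tau>))"]
      SO3_derivative_skew[OF L x, of "\<lambda>\<xi>. snd (q (\<xi>, t))"] q(2) x t
    unfolding w by auto
qed

lemma velocity_stress_body: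
  assumes q: "C_diff_on (Suc k) S q" and w: "w \<in> S"
  shows "velocity T q w = body (q w) (dt T q w)"
    and "stress L C Rc q w = matrix_inv (C (fst w)) *v (body (q w) (dx L q w) - stack e1 (curv L Rc (fst w)))"
proof -
  obtain x t where w: "w = (x, t)" and x: "x \<in> {0..L}" and t: "t \<in> {0..T}" using w by blast
  note D = C_diff_on_partials(3,4)[OF L T q(1) x t]
  note fst = bounded_linear.has_vector_derivative[OF bounded_linear_fst]
    and snd = bounded_linear.has_vector_derivative[OF bounded_linear_snd]
  have 1: "dt T (fst \<circ> q) w = fst (dt T q w)" "dt T (snd \<circ> q) w = snd (dt T q w)"
    unfolding w o_def by (rule dt_eqI[OF T t fst[OF D(2)]], rule dt_eqI[OF T t snd[OF D(2)]])
  have 2: "dx L (fst \<circ> q) w = fst (dx L q w)" "dx L (snd \<circ> q) w = snd (dx L q w)"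
    unfolding w o_def by (rule dx_eqI[OF L x fst[OF D(1)]], rule dx_eqI[OF L x snd[OF D(1)]])
  have "stack a b - stack c d = stack (a - c) (b - d)" for a b c d :: R3
    by (simp add: stack_def vec_eq_iff split: sum.split)
  then show "velocity T q w = body (q w) (dt T q w)"
      "stress L C Rc q w = matrix_inv (C (fst w)) *v (body (q w) (dx L q w) - stack e1 (curv L Rc (fst w)))"
    by (simp_all add: velocity_def stress_def body_def 1 2 Let_def)
qed

text \<open>One derivative is spent on \<open>dt T q\<close> and \<open>dx L q\<close>; what remains
  is algebra with C^1 factors, once skewness allows \<open>vee\<close> in place of
  \<open>axial\<close>.\<close>

lemma T_beam_C1:
  assumes q: "q \<in> C_space 2 S (UNIV \<times> SO3)"
  shows "T_beam T L C Rc q \<in> C_space 1 S UNIV"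
proof -
  have C2: "C_diff_on (Suc (Suc 0)) S q" and SO: "\<And>w. w \<in> S \<Longrightarrow> snd (q w) \<in> SO3"
    using C_spaceD[OF q] by (simp_all add: numeral_2_eq_2)
  note D = C_diff_on_partials(1,2)[OF L T C2]
  have body: "C_diff_on (Suc 0) S (\<lambda>w. body (q w) (D w))"
    if D: "C_diff_on (Suc 0) S D"
      and skew: "\<And>w. w \<in> S \<Longrightarrow> transpose (transpose (snd (q w)) ** snd (D w)) = - (transpose (snd (q w)) ** snd (D w))"
    for D
  proof -
    have "C_diff_on (Suc 0) S (\<lambda>w. stack (transpose (snd (q w)) *v fst (D w))
        (vee (transpose (snd (q w)) ** snd (D w))))"
      by (intro C_diff_on_stack C_diff_on_bilinear[OF bounded_bilinear_matrix_vector_mult]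
          C_diff_on_bilinear[OF bounded_bilinear_matrix_matrix_mult] C_diff_on_linear[OF bounded_linear_vee]
          C_diff_on_linear[OF bounded_linear_transpose] C_diff_on_linear[OF bounded_linear_fst]
          C_diff_on_linear[OF bounded_linear_snd] D C_diff_on_SucD[OF C2])
    then show ?thesis
      by (rule C_diff_on_cong[THEN iffD2, rotated]) (simp add: body_def axial_eq_vee skew)
  qed
  have "C_diff_on (Suc 0) S (\<lambda>w. stack (body (q w) (dt T q w))
      (matrix_inv (C (fst w)) *v (body (q w) (dx L q w) - stack e1 (curv L Rc (fst w)))))"
    by (intro C_diff_on_stack body[OF D(2) partials_skew(1)[OF C2 SO]] body[OF D(1) partials_skew(2)[OF C2 SO]]
        C_diff_on_matrix_inv_mult C_diff_on_compose_fst C_C1 C_diff_on_diff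
        C_diff_on_const C_diff_on_compose_fst[OF curv_C1] spd_invertible C_spd) auto
  then have "C_diff_on (Suc 0) S (T_beam T L C Rc q)"
    by (rule C_diff_on_cong[THEN iffD2, rotated])
       (simp add: T_beam_def velocity_stress_body[OF C2] restrict_apply')
  then show ?thesis by (simp add: C_space_def T_beam_def)
qed

text \<open>Pointwise everything can be undone: multiplication by \<open>C x\<close> reverses the
  constitutive law, and multiplication by the rotation reverses the passage to body coordinates. An
  equation nonlinear in \<open>q\<close> thus becomes a system linear in \<open>q\<close>.\<close>

lemma T_beam_eq_iff:
  assumes q: "C_diff_on (Suc k) S q" "\<And>w. w \<in> S \<Longrightarrow> snd (q w) \<in> SO3" and y: "y \<in> extensional S"
  shows "T_beam T L C Rc q = y \<longleftrightarrow> frame_eqs q y"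
proof -
  have pt: "stack (velocity T q w) (stress L C Rc q w) = y w \<longleftrightarrow>
      dt T q w = se3 (q w) (\<beta> y w) \<and> dx L q w = se3 (q w) (\<alpha> y w)" if w: "w \<in> S" for w
  proof -
    have x: "fst w \<in> {0..L}" using w by auto
    have "stress L C Rc q w = lower (y w) \<longleftrightarrow>
        body (q w) (dx L q w) - stack e1 (curv L Rc (fst w)) = C (fst w) *v lower (y w)"
      unfolding velocity_stress_body(2)[OF q(1) w] by (metis C_inverse[OF x])
    also have "\<dots> \<longleftrightarrow> body (q w) (dx L q w) = \<alpha> y w"
      by (simp add: \<alpha>_def strain_def diff_eq_eq)
    finally have "stack (velocity T q w) (stress L C Rc q w) = y w \<longleftrightarrow>
        body (q w) (dt T q w) = \<beta> y w \<and> body (q w) (dx L q w) = \<alpha> y w"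
      by (simp add: stack_eq_iff velocity_stress_body(1)[OF q(1) w] \<beta>_def)
    then show ?thesis
      using body_eq_iff[OF q(2)[OF w] partials_skew(1)[OF q w]] body_eq_iff[OF q(2)[OF w] partials_skew(2)[OF q w]]
      by simp
  qed
  have "T_beam T L C Rc q = y \<longleftrightarrow> (\<forall>w\<in>S. T_beam T L C Rc q w = y w)"
    using extensionalityI[of "T_beam T L C Rc q" S y] y by (auto simp: T_beam_def)
  also have "\<dots> \<longleftrightarrow> (\<forall>w\<in>S. dt T q w = se3 (q w) (\<beta> y w) \<and> dx L q w = se3 (q w) (\<alpha> y w))"
    by (intro ball_cong refl) (simp add: T_beam_def restrict_apply' pt)
  also have "\<dots> \<longleftrightarrow> frame_eqs q y"
  proof
    assume *: "\<forall>w\<in>S. dt T q w = se3 (q w) (\<beta> y w) \<and> dx L q w = se3 (q w) (\<alpha> y w)"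
    show "frame_eqs q y"
      unfolding frame_eqs_def
    proof (intro ballI)
      fix x t assume xt: "x \<in> {0..L}" "t \<in> {0..T}"
      then have "dt T q (x, t) = se3 (q (x, t)) (\<beta> y (x, t))" "dx L q (x, t) = se3 (q (x, t)) (\<alpha> y (x, t))"
        using * by auto
      with C_diff_on_partials(3,4)[OF L T q(1) xt]
      show "((\<lambda>\<xi>. q (\<xi>, t)) has_vector_derivative se3 (q (x, t)) (\<alpha> y (x, t))) (at x within {0..L}) \<and>
        ((\<lambda>\<tau>. q (x, \<tau>)) has_vector_derivative se3 (q (x, t)) (\<beta> y (x, t))) (at t within {0..T})"
        by simp
    qed
  next
    assume "frame_eqs q y"
    then show "\<forall>w\<in>S. dt T q w = se3 (q w) (\<beta> y w) \<and> dx L q w = se3 (q w) (\<alpha> y w)"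
      unfolding frame_eqs_def by (auto intro!: dt_eqI[OF T] dx_eqI[OF L])
  qed
  finally show ?thesis .
qed

section \<open>Conditions inherited by the image\<close>

lemma frame_eqsD:
  assumes "frame_eqs q y" "x \<in> {0..L}" "t \<in> {0..T}"
  shows "((\<lambda>\<xi>. q (\<xi>, t)) has_vector_derivative se3 (q (x, t)) (\<alpha> y (x, t))) (at x within {0..L})"
    and "((\<lambda>\<tau>. q (x, \<tau>)) has_vector_derivative se3 (q (x, t)) (\<beta> y (x, t))) (at t within {0..T})"
  using assms unfolding frame_eqs_def by blast+

text \<open>Each mixed derivative of \<open>q\<close> is computed by differentiating one frame
  equation in the other variable, with the product rule for \<open>se3\<close> and the other frame
  equation for the derivative of the frame. Their equality leaves an identity between values of
  \<open>se3 (q w)\<close>, and invertibility of the rotation cancels the frame.\<close>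

lemma frame_eqs_imp_compat_eq:
  assumes q: "C_diff_on (Suc (Suc 0)) S q" "\<And>w. w \<in> S \<Longrightarrow> snd (q w) \<in> SO3"
    and y: "C_diff_on (Suc 0) S y" and frame: "frame_eqs q y"
  shows "compat_eq T L C Rc y"
  unfolding compat_eq_iff[OF y]
proof
  fix w assume "w \<in> S"
  then obtain x t where w: "w = (x, t)" and x: "x \<in> {0..L}" and t: "t \<in> {0..T}" by blast
  let ?q = "q (x, t)" and ?a = "\<alpha> y (x, t)" and ?b = "\<beta> y (x, t)"
  note D = frame_eqsD[OF frame]
  interpret se3: bounded_bilinear se3 by (rule bounded_bilinear_se3)
  have "dt T (dx L q) (x, t) = se3 ?q (dt T (\<alpha> y) (x, t)) + se3 (se3 ?q ?b) ?a"
  proof (rule dt_eqI[OF T t has_vector_derivative_transform[OF t]])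
    show "dx L q (x, \<tau>) = se3 (q (x, \<tau>)) (\<alpha> y (x, \<tau>))" if "\<tau> \<in> {0..T}" for \<tau>
      by (rule dx_eqI[OF L x D(1)[OF x that]])
    show "((\<lambda>\<tau>. se3 (q (x, \<tau>)) (\<alpha> y (x, \<tau>))) has_vector_derivative
        se3 ?q (dt T (\<alpha> y) (x, t)) + se3 (se3 ?q ?b) ?a) (at t within {0..T})"
      by (intro se3.has_vector_derivative D C_diff_on_partials(4)[OF L T \<alpha>_C1[OF y]] x t)
  qed
  moreover have "dx L (dt T q) (x, t) = se3 ?q (dx L (\<beta> y) (x, t)) + se3 (se3 ?q ?a) ?b"
  proof (rule dx_eqI[OF L x has_vector_derivative_transform[OF x]])
    show "dt T q (\<xi>, t) = se3 (q (\<xi>, t)) (\<beta> y (\<xi>, t))" if "\<xi> \<in> {0..L}" for \<xi>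
      by (rule dt_eqI[OF T t D(2)[OF that t]])
    show "((\<lambda>\<xi>. se3 (q (\<xi>, t)) (\<beta> y (\<xi>, t))) has_vector_derivative
        se3 ?q (dx L (\<beta> y) (x, t)) + se3 (se3 ?q ?a) ?b) (at x within {0..L})"
      by (intro se3.has_vector_derivative D C_diff_on_partials(3)[OF L T \<beta>_C1[OF y]] x t)
  qed
  ultimately have "se3 ?q (dt T (\<alpha> y) (x, t) - dx L (\<beta> y) (x, t)) = se3 (se3 ?q ?a) ?b - se3 (se3 ?q ?b) ?a"
    using C2_mixed_partials_eq[OF L T q(1) x t] by (simp add: se3.diff_right algebra_simps)
  then show "dt T (\<alpha> y) w - dx L (\<beta> y) w = bracket (\<alpha> y w) (\<beta> y w)"
    using se3_inject[OF q(2)[of "(x, t)"]] x t unfolding se3_commutator w by simp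
qed

lemma frame_eqs_imp_initial_eq:
  assumes frame: "frame_eqs q y" and init: "\<And>x. x \<in> {0<..<L} \<Longrightarrow> q (x, 0) = (p0 x, R0 x)"
  shows "initial_eq L C Rc p0 R0 y"
proof -
  have "((\<lambda>\<xi>. (p0 \<xi>, R0 \<xi>)) has_vector_derivative se3 (p0 x, R0 x) (\<alpha> y (x, 0))) (at x)"
    if x: "x \<in> {0<..<L}" for x
  proof (rule has_vector_derivative_transform_within_open[OF _ open_greaterThanLessThan x init])
    show "((\<lambda>\<xi>. q (\<xi>, 0)) has_vector_derivative se3 (p0 x, R0 x) (\<alpha> y (x, 0))) (at x)"
      using frame_eqsD(1)[OF frame, of x 0] x T by (simp add: at_within_Icc_at init)
  qed
  from bounded_linear.has_vector_derivative[OF bounded_linear_fst this]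
    bounded_linear.has_vector_derivative[OF bounded_linear_snd this]
  show ?thesis
    by (simp add: initial_eq_def Let_def se3_def \<alpha>_def upper_add lower_add hat_add)
qed

lemma frame_eqs_imp_boundary_eq:
  assumes frame: "frame_eqs q y" and a: "a \<in> {0..L}"
    and bdry: "\<And>t. t \<in> {0<..<T} \<Longrightarrow> q (a, t) = (fp t, fR t)"
  shows "boundary_eq T fp fR a y"
proof -
  have "((\<lambda>\<tau>. (fp \<tau>, fR \<tau>)) has_vector_derivative se3 (fp t, fR t) (\<beta> y (a, t))) (at t)"
    if t: "t \<in> {0<..<T}" for t
  proof (rule has_vector_derivative_transform_within_open[OF _ open_greaterThanLessThan t bdry])
    show "((\<lambda>\<tau>. q (a, \<tau>)) has_vector_derivative se3 (fp t, fR t) (\<beta> y (a, t))) (at t)"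
      using frame_eqsD(2)[OF frame a, of t] t by (simp add: at_within_Icc_at bdry)
  qed
  from bounded_linear.has_vector_derivative[OF bounded_linear_fst this]
    bounded_linear.has_vector_derivative[OF bounded_linear_snd this]
  show ?thesis
    by (simp add: boundary_eq_def Let_def se3_def \<beta>_def)
qed

section \<open>Uniqueness and traces at the ends\<close>

lemma \<beta>_column_continuous:
  assumes "C_diff_on (Suc 0) S y" "a \<in> {0..L}"
  shows "continuous_on {0..T} (\<lambda>t. \<beta> y (a, t))"
  by (rule continuous_on_compose2[OF C_diff_on_imp_continuous_on[OF \<beta>_C1[OF assms(1)]]])
     (use assms(2) in \<open>auto intro: continuous_on_Pair\<close>)

text \<open>The initial values are known to agree on the open interval; continuity adds the two end
  columns, so that uniqueness in \<open>t\<close> covers every column.\<close>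

lemma frame_eqs_unique:
  assumes y: "C_diff_on (Suc 0) S y" and frame: "frame_eqs q y" "frame_eqs q' y"
    and cont: "continuous_on S q" "continuous_on S q'"
    and init: "\<And>x. x \<in> {0<..<L} \<Longrightarrow> q (x, 0) = q' (x, 0)" and w: "w \<in> S"
  shows "q w = q' w"
proof -
  obtain x t where w: "w = (x, t)" and x: "x \<in> {0..L}" and t: "t \<in> {0..T}" using w by blast
  have "continuous_on {0..L} (\<lambda>x. q (x, 0))" "continuous_on {0..L} (\<lambda>x. q' (x, 0))"
    using T by (auto intro!: continuous_on_compose2[OF cont(1)] continuous_on_compose2[OF cont(2)] continuous_intros)
  then have q0: "q (x, 0) = q' (x, 0)"
    by (rule continuous_eq_on_closed_interval[OF L _ _ init x])
  show ?thesis
    unfolding w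
    by (rule linear_ode_unique[OF bounded_bilinear_se3 \<beta>_column_continuous[OF y x]
          frame_eqsD(2)[OF frame(1) x] frame_eqsD(2)[OF frame(2) x] q0 t])
qed

text \<open>The column \<open>x = a\<close> and the data \<open>(fp, fR)\<close> solve one and the
  same equation in \<open>t\<close> from the same value, after the regularity of the data has
  carried \<open>boundary_eq\<close> to \<open>t = 0\<close> and \<open>t = T\<close>.\<close>

lemma frame_eqs_boundary_trace:
  assumes y: "C_diff_on (Suc 0) S y" and frame: "frame_eqs q y" and a: "a \<in> {0..L}"
    and f: "C_diff_on (Suc 0) {0..T} fp" "C_diff_on (Suc 0) {0..T} fR"
    and bdry: "boundary_eq T fp fR a y" and init: "q (a, 0) = (fp 0, fR 0)" and t: "t \<in> {0..T}"
  shows "q (a, t) = (fp t, fR t)"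
proof -
  have f': "C_diff_on (Suc 0) {0..T} (\<lambda>t. (fp t, fR t))"
    by (intro C_diff_on_Pair f)
  have der: "((\<lambda>t. (fp t, fR t)) has_vector_derivative se3 (fp t, fR t) (\<beta> y (a, t))) (at t within {0..T})"
    if t: "t \<in> {0..T}" for t
  proof (rule C1_has_vector_derivative_closed_interval[OF T f' _ _ t])
    show "continuous_on {0..T} (\<lambda>t. se3 (fp t, fR t) (\<beta> y (a, t)))"
      by (intro bounded_bilinear.continuous_on[OF bounded_bilinear_se3] \<beta>_column_continuous[OF y a]
          C_diff_on_imp_continuous_on[OF f'])
    show "((\<lambda>t. (fp t, fR t)) has_vector_derivative se3 (fp t, fR t) (\<beta> y (a, t))) (at t)"
      if "t \<in> {0<..<T}" for t
      using bdry that
      by (auto simp: boundary_eq_def Let_def se3_def \<beta>_def intro!: has_vector_derivative_Pair)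
  qed
  show ?thesis
    by (rule linear_ode_unique[OF bounded_bilinear_se3 \<beta>_column_continuous[OF y a]
          frame_eqsD(2)[OF frame a] der init t])
qed

section \<open>Construction of a frame field from its strains and velocities\<close>

lemma frame_exists:
  assumes y: "C_diff_on (Suc 0) S y" and compat: "compat_eq T L C Rc y"
    and p0: "C_diff_on (Suc 0) {0..L} p0" and R0: "C_diff_on (Suc 0) {0..L} R0"
    and R0_SO3: "\<And>x. x \<in> {0..L} \<Longrightarrow> R0 x \<in> SO3" and init: "initial_eq L C Rc p0 R0 y"
  obtains q where "q \<in> C_space 2 S (UNIV \<times> SO3)" "frame_eqs q y"
    "\<And>x. x \<in> {0..L} \<Longrightarrow> q (x, 0) = (p0 x, R0 x)"
proof -
  interpret se3: bounded_bilinear se3 by (rule bounded_bilinear_se3)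
  have \<alpha>: "C_diff_on (Suc 0) S (\<alpha> y)" and \<beta>: "C_diff_on (Suc 0) S (\<beta> y)"
    by (rule \<alpha>_C1[OF y], rule \<beta>_C1[OF y])
  note \<alpha>D = C_diff_on_partials[OF L T \<alpha>] and \<beta>D = C_diff_on_partials[OF L T \<beta>]
  define u0 where "u0 = (\<lambda>x. (p0 x, R0 x))"
  have u0_C1: "C_diff_on (Suc 0) {0..L} u0"
    unfolding u0_def by (intro C_diff_on_Pair p0 R0)
  have u0: "(u0 has_vector_derivative se3 (u0 x) (\<alpha> y (x, 0))) (at x within {0..L})" if x: "x \<in> {0..L}" for x
  proof (rule C1_has_vector_derivative_closed_interval[OF L u0_C1 _ _ x])
    have "continuous_on {0..L} (\<lambda>x. \<alpha> y (x, 0))"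
      by (rule continuous_on_compose2[OF C_diff_on_imp_continuous_on[OF \<alpha>]])
         (use T in \<open>auto intro: continuous_on_Pair\<close>)
    then show "continuous_on {0..L} (\<lambda>x. se3 (u0 x) (\<alpha> y (x, 0)))"
      by (intro se3.continuous_on C_diff_on_imp_continuous_on[OF u0_C1])
    show "(u0 has_vector_derivative se3 (u0 x) (\<alpha> y (x, 0))) (at x)" if "x \<in> {0<..<L}" for x
      using init that
      by (auto simp: initial_eq_def Let_def u0_def se3_def \<alpha>_def upper_add lower_add hat_add
          intro!: has_vector_derivative_Pair)
  qed
  \<comment> \<open>Compatibility, an identity in six components, is spread to all \<open>z\<close>
    through the commutator of \<open>se3\<close>; this is the form in which the system is
    solved.\<close>
  have comm: "se3 (se3 z (\<beta> y w)) (\<alpha> y w) + se3 z (dt T (\<alpha> y) w)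
      = se3 (se3 z (\<alpha> y w)) (\<beta> y w) + se3 z (dx L (\<beta> y) w)" if "w \<in> S" for w z
  proof -
    have "dt T (\<alpha> y) w = dx L (\<beta> y) w + bracket (\<alpha> y w) (\<beta> y w)"
      using bspec[OF compat[unfolded compat_eq_iff[OF y]] that] by (simp add: diff_eq_eq add.commute)
    then show ?thesis using se3_commutator[of z "\<alpha> y w" "\<beta> y w"]
      by (simp add: se3.add_right algebra_simps)
  qed
  have "\<exists>u. continuous_on S u \<and> (\<forall>x\<in>{0..L}. u (x, 0) = u0 x) \<and> frame_eqs u y"
    unfolding frame_eqs_def
    by (rule overdetermined_linear_system_exists[OF bounded_bilinear_se3 L T
        C_diff_on_imp_continuous_on[OF \<alpha>] C_diff_on_imp_continuous_on[OF \<beta>] \<alpha>D(4) \<beta>D(3)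
        C_diff_on_imp_continuous_on[OF \<beta>D(1)] comm u0])
  then obtain u where u_cont: "continuous_on S u" and u_init: "\<forall>x\<in>{0..L}. u (x, 0) = u0 x"
    and u: "frame_eqs u y"
    by blast
  note u' = frame_eqsD[OF u]
  \<comment> \<open>Bootstrap: if \<open>u\<close> has order \<open>k\<close>, so have
    \<open>se3 u \<alpha>\<close> and \<open>se3 u \<beta>\<close>, which are its partial
    derivatives. Two rounds lead from continuity to C^2; the bound \<open>k \<le> Suc 0\<close> is
    where the C^1 coefficients stop.\<close>
  have "C_diff_on (Suc k) S u" if "C_diff_on k S u" "k \<le> Suc 0" for k
  proof -
    have "C_diff_on k S (\<alpha> y)" "C_diff_on k S (\<beta> y)"
      using that(2) \<alpha> \<beta> C_diff_on_imp_continuous_on[OF \<alpha>] C_diff_on_imp_continuous_on[OF \<beta>]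
      by (auto simp: le_Suc_eq simp del: C_diff_on.simps(2))
    then show ?thesis
      by (intro C_diff_on_SucI_partials[OF u'] C_diff_on_bilinear[OF bounded_bilinear_se3] that)
  qed
  then have u_C2: "C_diff_on 2 S u"
    using u_cont by (simp add: numeral_2_eq_2 del: C_diff_on.simps(2))
  \<comment> \<open>The rotation part of each column is transported from \<open>R0 x\<close> by its
    own angular velocity, so it never leaves SO(3).\<close>
  have SO: "snd (u (x, t)) \<in> SO3" if x: "x \<in> {0..L}" and t: "t \<in> {0..T}" for x t
  proof (rule SO3_transport[OF T _ _ t, where \<omega> = "\<lambda>t. lower (\<beta> y (x, t))"])
    show "snd (u (x, 0)) \<in> SO3" using u_init R0_SO3 x by (simp add: u0_def)
    show "((\<lambda>\<tau>. snd (u (x, \<tau>))) has_vector_derivative snd (u (x, s)) ** hat (lower (\<beta> y (x, s)))) (at s within {0..T})"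
      if "s \<in> {0..T}" for s
      using bounded_linear.has_vector_derivative[OF bounded_linear_snd u'(2)[OF x that]]
      by (simp add: se3_def)
  qed
  \<comment> \<open>Members of \<open>C_space\<close> are \<open>undefined\<close> outside
    \<open>S\<close>; the restriction does not affect derivatives within the closed
    intervals.\<close>
  define q where "q = restrict u S"
  show thesis
  proof
    have "C_diff_on 2 S q"
      by (rule C_diff_on_cong[THEN iffD2, OF _ u_C2]) (simp add: q_def)
    moreover have "q \<in> S \<rightarrow>\<^sub>E UNIV \<times> SO3"
      using SO by (auto simp: q_def mem_Times_iff)
    ultimately show "q \<in> C_space 2 S (UNIV \<times> SO3)" by (simp add: C_space_def)
    show "q (x, 0) = (p0 x, R0 x)" if "x \<in> {0..L}" for x
      using u_init that T by (simp add: q_def u0_def)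
    show "frame_eqs q y"
      unfolding frame_eqs_def
    proof (intro ballI conjI)
      fix x t assume x: "x \<in> {0..L}" and t: "t \<in> {0..T}"
      have q: "q (x, t) = u (x, t)" using x t by (simp add: q_def)
      show "((\<lambda>\<xi>. q (\<xi>, t)) has_vector_derivative se3 (q (x, t)) (\<alpha> y (x, t))) (at x within {0..L})"
        unfolding q by (rule has_vector_derivative_transform[OF x _ u'(1)[OF x t]]) (use t in \<open>simp add: q_def\<close>)
      show "((\<lambda>\<tau>. q (x, \<tau>)) has_vector_derivative se3 (q (x, t)) (\<beta> y (x, t))) (at t within {0..T})"
        unfolding q by (rule has_vector_derivative_transform[OF t _ u'(2)[OF x t]]) (use x in \<open>simp add: q_def\<close>)
    qed
  qed
qed

end

section \<open>The network\<close>

lemma C2_imp_C1: "C_diff_on 2 A f \<Longrightarrow> C_diff_on (Suc 0) A f"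
  using C_diff_on_SucD[of "Suc 0"] by (simp add: numeral_2_eq_2 del: C_diff_on.simps)

lemma beam_network_imp_beam:
  assumes "beam_network G N nodes_D nodes_N len C Rc" "T > 0" "i \<in> {1..N}"
  shows "beam (len i) T (C i) (Rc i)"
proof -
  interpret beam_network G N nodes_D nodes_N len C Rc by (rule assms(1))
  show ?thesis
    using assms(2,3) len_pos C_C1 C_spd Rc_C2 Rc_SO3
    by unfold_locales (simp_all add: numeral_2_eq_2 del: C_diff_on.simps)
qed

text \<open>The cardinality 1 of the incident arcs gives the definite description in
  \<open>the_arc\<close> its value.\<close>

lemma beam_network_the_end:
  assumes "beam_network G N nodes_D nodes_N len C Rc" "n \<in> nodes_D"
  shows "the_arc G n \<in> {1..N}" "the_end G len n \<in> {0..len (the_arc G n)}"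
proof -
  interpret beam_network G N nodes_D nodes_N len C Rc by (rule assms(1))
  have "card (incident_arcs G n) = 1"
    using assms(2) simple_nodes_eq by (auto simp: simple_nodes_def)
  then obtain i where i: "incident_arcs G n = {i}" by (auto simp: card_1_singleton_iff)
  then have "the_arc G n = i" by (simp add: the_arc_def)
  moreover have "i \<in> incident_arcs G n" using i by simp
  then have "i \<in> arcs G" by (auto simp: incident_arcs_def in_arcs_def out_arcs_def)
  ultimately show arc: "the_arc G n \<in> {1..N}" by (simp add: arcs_eq)
  show "the_end G len n \<in> {0..len (the_arc G n)}"
    using len_pos[OF arc] by (simp add: the_end_def)
qed

theorem lemma3p3p5:
  fixes G :: "('n, nat) pre_digraph"
    and N :: nat
    and nodes_D nodes_N :: "'n set"
    and T :: real
    and len :: "nat \<Rightarrow> real"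
    and C :: "nat \<Rightarrow> real \<Rightarrow> R66"
    and Rc :: "nat \<Rightarrow> real \<Rightarrow> R33"
    and p0 :: "nat \<Rightarrow> real \<Rightarrow> R3"
    and R0 :: "nat \<Rightarrow> real \<Rightarrow> R33"
    and fp :: "'n \<Rightarrow> real \<Rightarrow> R3"
    and fR :: "'n \<Rightarrow> real \<Rightarrow> R33"
  assumes "beam_network G N nodes_D nodes_N len C Rc"
    and "T > 0"
    and "\<forall>i\<in>{1..N}. C_diff_on 2 {0..len i} (p0 i)"
    and "\<forall>i\<in>{1..N}. C_diff_on 2 {0..len i} (R0 i) \<and> R0 i ` {0..len i} \<subseteq> SO3"
    and "\<forall>n\<in>nodes_D. C_diff_on 2 {0..T} (fp n)"
    and "\<forall>n\<in>nodes_D. C_diff_on 2 {0..T} (fR n) \<and> fR n ` {0..T} \<subseteq> SO3"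
    and "\<forall>n\<in>nodes_D. fp n 0 = p0 (the_arc G n) (the_end G len n)
                    \<and> fR n 0 = R0 (the_arc G n) (the_end G len n)"
  shows "bij_betw (T_net N T len C Rc)
           (E1 G N nodes_D T len p0 R0 fp fR)
           (E2 G N nodes_D T len C Rc p0 R0 fp fR)"
proof -
  let ?E1 = "E1 G N nodes_D T len p0 R0 fp fR" and ?E2 = "E2 G N nodes_D T len C Rc p0 R0 fp fR"
  let ?T = "\<lambda>i. T_beam T (len i) (C i) (Rc i)" and ?S = "\<lambda>i. {0..len i} \<times> {0..T}"
  note beam = beam_network_imp_beam[OF assms(1,2)]
  note arc = beam_network_the_end(1)[OF assms(1)] and fin = beam_network_the_end(2)[OF assms(1)]
  have C1: "C_diff_on (Suc 0) (?S i) y" if "y \<in> C_space 1 (?S i) UNIV" for i and y :: "real \<times> real \<Rightarrow> R12"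
    using that by (simp add: C_space_def del: C_diff_on.simps)
  have frame: "beam.frame_eqs (len i) T (C i) (Rc i) q y \<longleftrightarrow> ?T i q = y"
    if "i \<in> {1..N}" "q \<in> C_space 2 (?S i) (UNIV \<times> SO3)" "y \<in> extensional (?S i)" for i q y
  proof -
    interpret beam "len i" T "C i" "Rc i" by (rule beam[OF that(1)])
    have "C_diff_on (Suc (Suc 0)) S q"
      using C_spaceD(1)[OF that(2)] by (simp add: numeral_2_eq_2 del: C_diff_on.simps)
    from T_beam_eq_iff[OF this C_spaceD(2)[OF that(2)] that(3)] show ?thesis by blast
  qed
  have T_C1: "?T i q \<in> C_space 1 (?S i) UNIV" if "i \<in> {1..N}" "q \<in> C_space 2 (?S i) (UNIV \<times> SO3)" for i q
    using beam.T_beam_C1[OF beam[OF that(1)] that(2)] .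
  have T_frame: "beam.frame_eqs (len i) T (C i) (Rc i) q (?T i q)"
    if "i \<in> {1..N}" "q \<in> C_space 2 (?S i) (UNIV \<times> SO3)" for i q
    using frame[OF that] by (simp add: T_beam_def)
  have E1_C2: "q i \<in> C_space 2 (?S i) (UNIV \<times> SO3)" if "q \<in> ?E1" "i \<in> {1..N}" for q i
    using that unfolding E1_def by (auto simp: PiE_iff)
  have inj: "inj_on (T_net N T len C Rc) ?E1"
  proof (rule inj_onI)
    fix q q' assume q: "q \<in> ?E1" and q': "q' \<in> ?E1" and eq: "T_net N T len C Rc q = T_net N T len C Rc q'"
    have "q i = q' i" if i: "i \<in> {1..N}" for i
    proof (rule extensionalityI[of _ "?S i"])
      interpret beam "len i" T "C i" "Rc i" by (rule beam[OF i])
      note qi = E1_C2[OF q i] and q'i = E1_C2[OF q' i]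
      show "q i \<in> extensional (?S i)" "q' i \<in> extensional (?S i)"
        using qi q'i by (auto simp: C_space_def PiE_iff)
      \<comment> \<open>Equal images turn \<open>q i\<close> and \<open>q' i\<close> into solutions
        of frame equations with the same coefficients.\<close>
      have y: "?T i (q i) = ?T i (q' i)"
        using fun_cong[OF eq, of i] i by (simp add: T_net_def)
      show "q i w = q' i w" if w: "w \<in> ?S i" for w
      proof (rule frame_eqs_unique[OF C1[OF T_C1[OF i qi]] T_frame[OF i qi] _ _ _ _ w])
        show "frame_eqs (q' i) (?T i (q i))" unfolding y by (rule T_frame[OF i q'i])
        show "continuous_on (?S i) (q i)" "continuous_on (?S i) (q' i)"
          using C_diff_on_imp_continuous_on C_spaceD(1)[OF qi] C_spaceD(1)[OF q'i] by blast+
        show "q i (x, 0) = q' i (x, 0)" if "x \<in> {0<..<len i}" for x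
          using q q' i that unfolding E1_def by simp
      qed
    qed
    moreover have "q \<in> extensional {1..N}" "q' \<in> extensional {1..N}"
      using q q' unfolding E1_def by (auto simp: PiE_iff)
    ultimately show "q = q'" by (intro extensionalityI[of q "{1..N}" q'])
  qed
  have into: "T_net N T len C Rc q \<in> ?E2" if q: "q \<in> ?E1" for q
    unfolding E2_def
  proof (intro CollectI conjI ballI)
    have net: "T_net N T len C Rc q i = ?T i (q i)" if "i \<in> {1..N}" for i
      using that by (simp add: T_net_def)
    show "T_net N T len C Rc q \<in> (\<Pi>\<^sub>E i\<in>{1..N}. C_space 1 (?S i) UNIV)"
      using T_C1 E1_C2[OF q] by (auto simp: T_net_def simp del: One_nat_def)
    fix i assume i: "i \<in> {1..N}"
    interpret beam "len i" T "C i" "Rc i" by (rule beam[OF i])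
    note qi = E1_C2[OF q i]
    have "C_diff_on (Suc (Suc 0)) (?S i) (q i)"
      using C_spaceD(1)[OF qi] by (simp add: numeral_2_eq_2 del: C_diff_on.simps)
    then show "compat_eq T (len i) (C i) (Rc i) (T_net N T len C Rc q i)"
      unfolding net[OF i]
      by (rule frame_eqs_imp_compat_eq[OF _ C_spaceD(2)[OF qi] C1[OF T_C1[OF i qi]] T_frame[OF i qi]])
    show "initial_eq (len i) (C i) (Rc i) (p0 i) (R0 i) (T_net N T len C Rc q i)"
      unfolding net[OF i] using q i
      by (intro frame_eqs_imp_initial_eq[OF T_frame[OF i qi]]) (simp add: E1_def)
  next
    fix n assume n: "n \<in> nodes_D"
    interpret beam "len (the_arc G n)" T "C (the_arc G n)" "Rc (the_arc G n)" by (rule beam[OF arc[OF n]])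
    have "T_net N T len C Rc q (the_arc G n) = ?T (the_arc G n) (q (the_arc G n))"
      using arc[OF n] by (simp add: T_net_def)
    then show "boundary_eq T (fp n) (fR n) (the_end G len n) (T_net N T len C Rc q (the_arc G n))"
      using frame_eqs_imp_boundary_eq[OF T_frame[OF arc[OF n] E1_C2[OF q arc[OF n]]] fin[OF n], of "fp n" "fR n"] q n
      by (simp add: E1_def)
  qed
  have onto: "\<exists>q\<in>?E1. T_net N T len C Rc q = y" if y: "y \<in> ?E2" for y
  proof -
    have y_C: "y i \<in> C_space 1 (?S i) UNIV" if "i \<in> {1..N}" for i
      using y that unfolding E2_def by (auto simp: PiE_iff simp del: One_nat_def)
    have y_ext: "y i \<in> extensional (?S i)" if "i \<in> {1..N}" for i
      using y_C[OF that] by (auto simp: C_space_def PiE_iff)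
    \<comment> \<open>Here the initial frame is imposed; the Dirichlet conditions are verified
      below.\<close>
    have "\<exists>q. q \<in> C_space 2 (?S i) (UNIV \<times> SO3) \<and> ?T i q = y i \<and> (\<forall>x\<in>{0..len i}. q (x, 0) = (p0 i x, R0 i x))"
      if i: "i \<in> {1..N}" for i
    proof -
      interpret beam "len i" T "C i" "Rc i" by (rule beam[OF i])
      obtain q where q: "q \<in> C_space 2 (?S i) (UNIV \<times> SO3)" "frame_eqs q (y i)"
          "\<And>x. x \<in> {0..len i} \<Longrightarrow> q (x, 0) = (p0 i x, R0 i x)"
      proof (rule frame_exists[OF C1[OF y_C[OF i]]])
        show "compat_eq T (len i) (C i) (Rc i) (y i)" "initial_eq (len i) (C i) (Rc i) (p0 i) (R0 i) (y i)"
          using y i unfolding E2_def by blast+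
        show "C_diff_on (Suc 0) {0..len i} (p0 i)" "C_diff_on (Suc 0) {0..len i} (R0 i)"
          using assms(3,4) i C2_imp_C1 by blast+
        show "R0 i x \<in> SO3" if "x \<in> {0..len i}" for x
          using assms(4) i that by blast
      qed blast
      then show ?thesis using frame[OF i q(1) y_ext[OF i]] by blast
    qed
    then obtain q where q_C2: "\<And>i. i \<in> {1..N} \<Longrightarrow> q i \<in> C_space 2 (?S i) (UNIV \<times> SO3)"
      and q_T: "\<And>i. i \<in> {1..N} \<Longrightarrow> ?T i (q i) = y i"
      and q_0: "\<And>i x. i \<in> {1..N} \<Longrightarrow> x \<in> {0..len i} \<Longrightarrow> q i (x, 0) = (p0 i x, R0 i x)"
      by metis
    define r where "r = restrict q {1..N}"
    have "r \<in> ?E1"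
      unfolding E1_def
    proof (intro CollectI conjI ballI)
      show "r \<in> (\<Pi>\<^sub>E i\<in>{1..N}. C_space 2 (?S i) (UNIV \<times> SO3))"
        using q_C2 by (auto simp: r_def)
      show "r i (x, 0) = (p0 i x, R0 i x)" if "i \<in> {1..N}" "x \<in> {0<..<len i}" for i x
        using q_0[OF that(1)] that by (simp add: r_def)
      fix n t assume n: "n \<in> nodes_D" and t: "t \<in> {0<..<T}"
      let ?i = "the_arc G n"
      note i = arc[OF n]
      interpret beam "len ?i" T "C ?i" "Rc ?i" by (rule beam[OF i])
      have "q ?i (the_end G len n, t) = (fp n t, fR n t)"
      proof (rule frame_eqs_boundary_trace[OF C1[OF y_C[OF i]] _ fin[OF n]])
        show "frame_eqs (q ?i) (y ?i)"
          using frame[OF i q_C2[OF i] y_ext[OF i]] q_T[OF i] by blast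
        show "C_diff_on (Suc 0) {0..T} (fp n)" "C_diff_on (Suc 0) {0..T} (fR n)"
          using assms(5,6) n C2_imp_C1 by blast+
        show "boundary_eq T (fp n) (fR n) (the_end G len n) (y ?i)"
          using y n unfolding E2_def by blast
        \<comment> \<open>This is the agreement of node data and initial frames. A node sits at an
          end of its edge, so the initial condition is used at an endpoint, where it was obtained
          along with the interior.\<close>
        show "q ?i (the_end G len n, 0) = (fp n 0, fR n 0)"
          using q_0[OF i fin[OF n]] assms(7) n by simp
      qed (use t in auto)
      then show "r ?i (the_end G len n, t) = (fp n t, fR n t)"
        using i by (simp add: r_def)
    qed
    moreover have "T_net N T len C Rc r = y"
    proof (rule extensionalityI[of _ "{1..N}"])
      show "y \<in> extensional {1..N}" using y unfolding E2_def by (auto simp: PiE_iff)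
      show "T_net N T len C Rc r i = y i" if "i \<in> {1..N}" for i
        using q_T[OF that] that by (simp add: T_net_def r_def)
    qed (simp add: T_net_def)
    ultimately show ?thesis by blast
  qed
  show ?thesis
    unfolding bij_betw_def using inj into onto by (auto simp: image_iff)
qed

end
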